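(* Let $p$ be a constant and let $q:\mathbb{R}^2_+\to\mathbb{R}$ be a measurable function such that $1<p\le q_-\le q_+<\infty$. Suppose that $v$ and $w$ are weights on $\mathbb{R}^2_+$ with $w(x,y)=w_1(x)w_2(y)$ for some one-dimensional weights $w_1$ and $w_2$ on $\mathbb{R}_+$. Then $\mathcal{H}_2$ is bounded from $L^p_w(\mathbb{R}^2_+)$ to $L^{q(\cdot)}_v(\mathbb{R}^2_+)$ if and only if $$B:=\sup_{a,b>0}\big\|v\,\chi_{J^\infty_{ab}}\big\|_{L^{q(\cdot)}(\mathbb{R}^2_+)}\,\Big\|\frac1w\,\chi_{J^0_{ab}}\Big\|_{L^{p'}(\mathbb{R}^2_+)}<\infty,$$ where $J^\infty_{ab}=[a,\infty)\times[b,\infty)$ and $J^0_{ab}=[0,a)\times[0,b)$.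
   Context: $\mathbb{R}_+=[0,\infty)$, $\mathbb{R}^2_+=[0,\infty)^2$, $p'=p/(p-1)$, $q_-=\inf_{\mathbb{R}^2_+}q$, $q_+=\sup_{\mathbb{R}^2_+}q$; $\chi_E$ is the indicator of $E$. A weight is an almost everywhere positive measurable function. The norm of $L^{q(\cdot)}(\mathbb{R}^2_+)$ is $\|f\|_{L^{q(\cdot)}}=\inf\{\lambda>0:\int|f(x)/\lambda|^{q(x)}dx\le1\}$, and the weighted space is defined by $\|f\|_{L^{q(\cdot)}_v}=\|fv\|_{L^{q(\cdot)}}$ (so for the constant exponent $p$, $\|f\|_{L^p_w}=\|fw\|_{L^p}$). The double Hardy transform is $(\mathcal{H}_2f)(x,y)=\int_0^x\int_0^y f(t,\tau)\,dt\,d\tau$, $(x,y)\in\mathbb{R}^2_+$. Bounded means that there is $c>0$ with $\|\mathcal{H}_2f\|_{L^{q(\cdot)}_v}\le c\|f\|_{L^p_w}$ for all $f\in L^p_w(\mathbb{R}^2_+)$ (in particular $\mathcal{H}_2 f$ is well defined). *)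

theory Defs
  imports "HOL-Analysis.Analysis"
begin

text \<open>Functions on the quadrant are total functions on \<^typ>\<open>real \<times> real\<close> whose values outside the
  quadrant are irrelevant. Measurability is Lebesgue measurability.\<close>

definition quadrant :: "(real \<times> real) set"
  where "quadrant = {0..} \<times> {0..}"

definition weight_on :: "'a::euclidean_space set \<Rightarrow> ('a \<Rightarrow> real) \<Rightarrow> bool"
  where "weight_on S v \<longleftrightarrow>
    v \<in> borel_measurable (lebesgue_on S) \<and> (AE z in lebesgue_on S. 0 < v z)"

definition exp_minus :: "(real \<times> real \<Rightarrow> real) \<Rightarrow> ereal"
  where "exp_minus q = (INF z\<in>quadrant. ereal (q z))"

definition exp_plus :: "(real \<times> real \<Rightarrow> real) \<Rightarrow> ereal"
  where "exp_plus q = (SUP z\<in>quadrant. ereal (q z))"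

text \<open>The norm of the variable exponent space on the quadrant; it is \<open>\<infinity>\<close> when no \<open>l\<close> is admissible.
  The norm of the space with a constant exponent \<open>r\<close> is \<^term>\<open>Lq_norm (\<lambda>_. r)\<close>.\<close>

definition Lq_norm :: "(real \<times> real \<Rightarrow> real) \<Rightarrow> (real \<times> real \<Rightarrow> real) \<Rightarrow> ennreal"
  where "Lq_norm q f =
    (INF l \<in> {l::real. 0 < l \<and>
        (\<integral>\<^sup>+ z. ennreal (\<bar>f z / l\<bar> powr q z) \<partial>lebesgue_on quadrant) \<le> 1}. ennreal l)"

definition wLq_norm ::
    "(real \<times> real \<Rightarrow> real) \<Rightarrow> (real \<times> real \<Rightarrow> real) \<Rightarrow> (real \<times> real \<Rightarrow> real) \<Rightarrow> ennreal"
  where "wLq_norm q v f = Lq_norm q (\<lambda>z. f z * v z)"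

definition wLq_space ::
    "(real \<times> real \<Rightarrow> real) \<Rightarrow> (real \<times> real \<Rightarrow> real) \<Rightarrow> (real \<times> real \<Rightarrow> real) set"
  where "wLq_space q v =
    {f. f \<in> borel_measurable (lebesgue_on quadrant) \<and> wLq_norm q v f < \<infinity>}"

definition hardy2 :: "(real \<times> real \<Rightarrow> real) \<Rightarrow> real \<times> real \<Rightarrow> real"
  where "hardy2 f = (\<lambda>(x, y). set_lebesgue_integral lebesgue ({0..x} \<times> {0..y}) f)"

text \<open>The integrability clause says that \<^term>\<open>hardy2 f\<close> is well defined; without it the Bochner
  integral would silently be \<open>0\<close> for non-integrable \<open>f\<close>.\<close>

definition hardy2_bounded ::
    "real \<Rightarrow> (real \<times> real \<Rightarrow> real) \<Rightarrow> (real \<times> real \<Rightarrow> real) \<Rightarrow> (real \<times> real \<Rightarrow> real) \<Rightarrow> bool"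
  where "hardy2_bounded p w q v \<longleftrightarrow>
    (\<exists>c::real. 0 < c \<and>
      (\<forall>f \<in> wLq_space (\<lambda>_. p) w.
         (\<forall>(x, y) \<in> quadrant. set_integrable lebesgue ({0..x} \<times> {0..y}) f) \<and>
         wLq_norm q v (hardy2 f) \<le> ennreal c * wLq_norm (\<lambda>_. p) w f))"

end

theory Submission
  imports Defs
begin

text \<open>
  Write \<open>r = p / (p - 1)\<close>, \<open>J\<close> for the rectangle \<open>[0,a) \<times> [0,b)\<close> and \<open>T\<close> for the tail
  \<open>[a,\<infinity>) \<times> [b,\<infinity>)\<close>.

  Necessity uses test functions. A truncation \<open>f\<close> of \<open>w\<close> to the power \<open>-r\<close>, supported in \<open>J\<close>,
  satisfies \<open>(f w)^p = f\<close>, and its Hardy transform equals the constant \<open>I = \<integral>f\<close> on \<open>T\<close>. Boundedness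
  therefore gives \<open>I * \<parallel>v \<chi>_T\<parallel> \<le> c * I^(1/p)\<close>. Dividing by \<open>I^(1/p)\<close> and letting the truncation
  increase turns this into \<open>\<parallel>v \<chi>_T\<parallel> * \<parallel>(1/w) \<chi>_J\<parallel> \<le> c\<close>; see \<open>norm_tail_times_norm_dual_le\<close>.

  Sufficiency rests on a discretisation. Since \<open>w\<close> is a product,
  the \<open>L^r\<close> norm of \<open>(1/w) \<chi>_J\<close> is \<open>(S1(a) * S2(b))^(1/r)\<close>, where \<open>S1\<close> and \<open>S2\<close> are the primitives of
  \<open>w1^(-r)\<close> and \<open>w2^(-r)\<close>. Cut each half-line where its primitive crosses a power of 4, and let
  \<open>n1\<close> and \<open>n2\<close> be the level functions (\<open>dyadic_levels\<close>). On the block of level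
  \<open>(i,j)\<close> two things hold. First, \<open>|hardy2 f|\<close> is at most the integral \<open>F i j\<close> of \<open>|f|\<close> over all blocks
  of lower or equal level in both directions. Secondly, the hypothesis at the lower left corner of the block says that
  \<open>v * 4^((i+j)/r) / B\<close> has modular at most 1 there. So with \<open>t i j\<close> a small constant times
  \<open>F i j / 4^((i+j)/r)\<close> the modular of \<open>v * hardy2 f\<close> on the block is at most \<open>t^p\<close>, because
  \<open>t \<le> 1\<close> and \<open>q \<ge> p\<close> give \<open>t^q \<le> t^p\<close>. This is the only point where the exponent varies, and what
  remains is the constant exponent inequality \<open>\<Sum> t^p \<le> 1\<close>.

  That inequality follows from Hoelder's inequality with the auxiliary factor
  \<open>2^((n1 + n2)/r)\<close>. The dual factor \<open>\<integral> 2^(-n1-n2) w^(-r)\<close> over the lower blocks is, again by the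
  product structure, a product of two geometric sums of size \<open>2^i\<close> and \<open>2^j\<close>; in the other factor
  the sum over \<open>(i,j)\<close> is, at each fixed point, a geometric series. This part involves only the two level
  functions and is carried out on an abstract measure space in \<open>level_modular_bound\<close>.
\<close>


section \<open>The Luxemburg norm and its modular\<close>

lemma Lq_norm_le:
  assumes "0 < l" "(\<integral>\<^sup>+ z. ennreal (\<bar>f z / l\<bar> powr q z) \<partial>lebesgue_on quadrant) \<le> 1"
  shows "Lq_norm q f \<le> ennreal l"
  unfolding Lq_norm_def using assms by (intro INF_lower) auto

lemma space_quadrant [simp]: "space (lebesgue_on quadrant) = quadrant"
  by (simp add: space_restrict_space)

text \<open>A scale strictly above the norm dominates some admissible scale, and the modular decreases in the
  scale.\<close>

lemma modular_le_1_if_Lq_norm_less: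
  assumes "Lq_norm q f < ennreal l" and q: "\<And>z. z \<in> quadrant \<Longrightarrow> 0 \<le> q z"
  shows "(\<integral>\<^sup>+ z. ennreal (\<bar>f z / l\<bar> powr q z) \<partial>lebesgue_on quadrant) \<le> 1"
proof -
  from assms(1) obtain k where k: "0 < k" "ennreal k < ennreal l"
    "(\<integral>\<^sup>+ z. ennreal (\<bar>f z / k\<bar> powr q z) \<partial>lebesgue_on quadrant) \<le> 1"
    unfolding Lq_norm_def INF_less_iff by auto
  then have kl: "k < l" by (simp add: ennreal_less_iff)
  have "(\<integral>\<^sup>+ z. ennreal (\<bar>f z / l\<bar> powr q z) \<partial>lebesgue_on quadrant)
      \<le> (\<integral>\<^sup>+ z. ennreal (\<bar>f z / k\<bar> powr q z) \<partial>lebesgue_on quadrant)"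
    using k(1) kl q
    by (intro nn_integral_mono ennreal_leI powr_mono2)
       (auto simp: abs_divide intro!: divide_left_mono)
  with k(3) show ?thesis by simp
qed

lemma Lq_norm_mono:
  assumes "\<And>z. z \<in> quadrant \<Longrightarrow> \<bar>f z\<bar> \<le> \<bar>g z\<bar>" and q: "\<And>z. z \<in> quadrant \<Longrightarrow> 0 \<le> q z"
  shows "Lq_norm q f \<le> Lq_norm q g"
  unfolding Lq_norm_def[of q g]
proof (rule INF_greatest, clarify)
  fix l :: real
  assume l: "0 < l" "(\<integral>\<^sup>+ z. ennreal (\<bar>g z / l\<bar> powr q z) \<partial>lebesgue_on quadrant) \<le> 1"
  have "(\<integral>\<^sup>+ z. ennreal (\<bar>f z / l\<bar> powr q z) \<partial>lebesgue_on quadrant)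
      \<le> (\<integral>\<^sup>+ z. ennreal (\<bar>g z / l\<bar> powr q z) \<partial>lebesgue_on quadrant)"
    using assms l(1)
    by (intro nn_integral_mono ennreal_leI powr_mono2)
       (auto simp: abs_divide intro!: divide_right_mono)
  with l show "Lq_norm q f \<le> ennreal l" by (intro Lq_norm_le) auto
qed

lemma Lq_norm_scale_le:
  assumes c: "0 < c"
  shows "ennreal c * Lq_norm q f \<le> Lq_norm q (\<lambda>z. c * f z)"
  unfolding Lq_norm_def[of q "\<lambda>z. c * f z"]
proof (rule INF_greatest, clarify)
  fix l :: real
  assume l: "0 < l" "(\<integral>\<^sup>+ z. ennreal (\<bar>c * f z / l\<bar> powr q z) \<partial>lebesgue_on quadrant) \<le> 1"
  have "Lq_norm q f \<le> ennreal (l / c)"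
    using l c by (intro Lq_norm_le) (auto simp: field_simps)
  then have "ennreal c * Lq_norm q f \<le> ennreal c * ennreal (l / c)"
    by (rule mult_left_mono) simp
  also have "\<dots> = ennreal l" using c l by (simp flip: ennreal_mult)
  finally show "ennreal c * Lq_norm q f \<le> ennreal l" .
qed

text \<open>For a constant exponent the scale factors out of the modular. This makes the norm the usual
  \<open>(\<integral>|f|^r)^(1/r)\<close>; the next three lemmas are the one-sided estimates that follow, in a form that
  copes with infinite integrals.\<close>

lemma modular_const_le_1_iff:
  assumes f: "f \<in> borel_measurable (lebesgue_on quadrant)" and l: "0 < l"
  shows "(\<integral>\<^sup>+ z. ennreal (\<bar>f z / l\<bar> powr r) \<partial>lebesgue_on quadrant) \<le> 1 \<longleftrightarrow>
     (\<integral>\<^sup>+ z. ennreal (\<bar>f z\<bar> powr r) \<partial>lebesgue_on quadrant) \<le> ennreal (l powr r)"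
proof -
  have "(\<integral>\<^sup>+ z. ennreal (\<bar>f z\<bar> powr r) \<partial>lebesgue_on quadrant)
      = (\<integral>\<^sup>+ z. ennreal (l powr r) * ennreal (\<bar>f z / l\<bar> powr r) \<partial>lebesgue_on quadrant)"
    using l by (intro nn_integral_cong) (simp add: abs_divide powr_divide flip: ennreal_mult)
  also have "\<dots> = ennreal (l powr r) * (\<integral>\<^sup>+ z. ennreal (\<bar>f z / l\<bar> powr r) \<partial>lebesgue_on quadrant)"
    using f by (intro nn_integral_cmult) measurable
  finally have eq: "(\<integral>\<^sup>+ z. ennreal (\<bar>f z\<bar> powr r) \<partial>lebesgue_on quadrant)
      = ennreal (l powr r) * (\<integral>\<^sup>+ z. ennreal (\<bar>f z / l\<bar> powr r) \<partial>lebesgue_on quadrant)" .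
  show ?thesis
    unfolding eq using l ennreal_mult_le_mult_iff[of "ennreal (l powr r)" _ 1] by simp
qed

lemma Lq_norm_const_le:
  assumes "f \<in> borel_measurable (lebesgue_on quadrant)" "0 < l"
    and "(\<integral>\<^sup>+ z. ennreal (\<bar>f z\<bar> powr r) \<partial>lebesgue_on quadrant) \<le> ennreal (l powr r)"
  shows "Lq_norm (\<lambda>_. r) f \<le> ennreal l"
  using Lq_norm_le[OF assms(2), of f "\<lambda>_. r"] modular_const_le_1_iff[OF assms(1,2)] assms(3) by auto

lemma integral_le_if_Lq_norm_const_less:
  assumes f: "f \<in> borel_measurable (lebesgue_on quadrant)" and r: "0 \<le> r"
    and less: "Lq_norm (\<lambda>_. r) f < ennreal l"
  shows "(\<integral>\<^sup>+ z. ennreal (\<bar>f z\<bar> powr r) \<partial>lebesgue_on quadrant) \<le> ennreal (l powr r)"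
proof -
  have "0 < l" using less by (metis ennreal_less_zero_iff not_gr_zero not_less_zero)
  then show ?thesis
    using modular_le_1_if_Lq_norm_less[OF less] modular_const_le_1_iff[OF f] r by auto
qed

lemma le_Lq_norm_const:
  assumes f: "f \<in> borel_measurable (lebesgue_on quadrant)" and r: "0 < r" and s: "0 \<le> s"
    and ge: "ennreal s \<le> (\<integral>\<^sup>+ z. ennreal (\<bar>f z\<bar> powr r) \<partial>lebesgue_on quadrant)"
  shows "ennreal (s powr (1 / r)) \<le> Lq_norm (\<lambda>_. r) f"
proof (rule ccontr)
  assume "\<not> ?thesis"
  then have "Lq_norm (\<lambda>_. r) f < ennreal (s powr (1 / r))" by simp
  then obtain l where l: "Lq_norm (\<lambda>_. r) f < ennreal l" "l < s powr (1 / r)" "0 \<le> l"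
    by (metis dense ennreal_cases ennreal_less_iff linorder_not_less top_greatest order_less_imp_le)
  have "ennreal s \<le> ennreal (l powr r)"
    using order_trans[OF ge integral_le_if_Lq_norm_const_less[OF f _ l(1)]] r by simp
  then have "s \<le> l powr r" by simp
  moreover have "l powr r < s"
    using powr_less_mono2[OF r l(3) l(2)] r s by (simp add: powr_powr)
  ultimately show False by simp
qed

text \<open>For \<open>0 < l \<le> 1\<close> and \<open>q \<ge> p\<close> one has \<open>|f|^q \<le> l^p * |f / l|^q\<close>. If the norm vanished, every such \<open>l\<close>
  would be admissible, so that \<open>\<integral>|f|^q \<le> l^p\<close> could be made arbitrarily small.\<close>

lemma Lq_norm_pos:
  assumes f: "f \<in> borel_measurable (lebesgue_on quadrant)"
    and qm: "q \<in> borel_measurable (lebesgue_on quadrant)"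
    and p: "0 < p" and q: "\<And>z. z \<in> quadrant \<Longrightarrow> p \<le> q z"
    and nz: "\<not> (AE z in lebesgue_on quadrant. f z = 0)"
  shows "0 < Lq_norm q f"
proof (rule ccontr)
  assume "\<not> ?thesis"
  then have 0: "Lq_norm q f = 0" by simp
  define I where "I = (\<integral>\<^sup>+ z. ennreal (\<bar>f z\<bar> powr q z) \<partial>lebesgue_on quadrant)"
  note [measurable] = f qm
  have "I \<le> ennreal e" if e: "0 < e" "e < 1" for e
  proof -
    define l where "l = e powr (1 / p)"
    have l: "0 < l" "l \<le> 1" "l powr p = e"
      using e p by (auto simp: l_def powr_powr powr_le1)
    have "I \<le> (\<integral>\<^sup>+ z. ennreal (l powr p) * ennreal (\<bar>f z / l\<bar> powr q z) \<partial>lebesgue_on quadrant)"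
      unfolding I_def
    proof (rule nn_integral_mono)
      fix z assume "z \<in> space (lebesgue_on quadrant)"
      then have z: "p \<le> q z" using q by auto
      have "\<bar>f z\<bar> powr q z = l powr q z * \<bar>f z / l\<bar> powr q z"
        using l by (simp add: abs_divide powr_divide)
      also have "\<dots> \<le> l powr p * \<bar>f z / l\<bar> powr q z"
        using l z by (intro mult_right_mono powr_mono') auto
      finally show "ennreal (\<bar>f z\<bar> powr q z) \<le> ennreal (l powr p) * ennreal (\<bar>f z / l\<bar> powr q z)"
        by (simp flip: ennreal_mult)
    qed
    also have "\<dots> = ennreal (l powr p) * (\<integral>\<^sup>+ z. ennreal (\<bar>f z / l\<bar> powr q z) \<partial>lebesgue_on quadrant)"
      by (rule nn_integral_cmult) simp
    also have "\<dots> \<le> ennreal (l powr p) * 1"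
      using l 0 q p by (intro mult_left_mono modular_le_1_if_Lq_norm_less) (auto intro: order_trans[of 0 p])
    finally show ?thesis using l by simp
  qed
  note le = this
  have "I \<le> 0"
  proof (rule ennreal_le_epsilon)
    fix e :: real assume "0 < e"
    then show "I \<le> 0 + ennreal e"
      using order_trans[OF le[of "min e (1/2)"] ennreal_leI[of "min e (1/2)" e]] by simp
  qed
  then have "I = 0" by simp
  then have "AE z in lebesgue_on quadrant. \<bar>f z\<bar> powr q z = 0"
    unfolding I_def using f qm by (subst (asm) nn_integral_0_iff_AE) (auto elim!: AE_mp)
  with nz show False by (auto elim!: AE_mp)
qed


section \<open>Hoelder's inequality\<close>

text \<open>Young's inequality for \<open>u\<close> and \<open>g\<close>, normalised by \<open>a^(1/p)\<close> and \<open>b^(1/r)\<close>, integrates to the claim.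
  Stating it with upper bounds \<open>a\<close>, \<open>b\<close> instead of the exact integrals keeps roots of extended reals out of the
  inequality; only \<open>a = 0\<close> is then a degenerate case.\<close>

lemma nn_integral_Holder:
  fixes u g :: "'a \<Rightarrow> real"
  assumes [measurable]: "u \<in> borel_measurable M" "g \<in> borel_measurable M"
    and pr: "1 < p" "1 < r" "1 / p + 1 / r = (1::real)"
    and nonneg: "\<And>x. x \<in> space M \<Longrightarrow> 0 \<le> u x" "\<And>x. x \<in> space M \<Longrightarrow> 0 \<le> g x"
    and a: "0 \<le> a" "(\<integral>\<^sup>+x. ennreal (u x powr p) \<partial>M) \<le> ennreal a"
    and b: "0 < b" "(\<integral>\<^sup>+x. ennreal (g x powr r) \<partial>M) \<le> ennreal b"
  shows "(\<integral>\<^sup>+x. ennreal (u x * g x) \<partial>M) \<le> ennreal (a powr (1 / p) * b powr (1 / r))"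
proof (cases "a = 0")
  case True
  with a have "(\<integral>\<^sup>+x. ennreal (u x powr p) \<partial>M) = 0" by simp
  then have "AE x in M. u x powr p \<le> 0"
    by (subst (asm) nn_integral_0_iff_AE) (auto simp: ennreal_eq_0_iff)
  then have "AE x in M. ennreal (u x * g x) = 0"
    by eventually_elim (auto simp: dual_order.antisym)
  then have "(\<integral>\<^sup>+x. ennreal (u x * g x) \<partial>M) = 0"
    by (subst nn_integral_0_iff_AE) auto
  then show ?thesis by simp
next
  case False
  with a have a0: "0 < a" by simp
  define \<alpha> \<beta> where "\<alpha> = a powr (1 / p)" and "\<beta> = b powr (1 / r)"
  have pos: "0 < \<alpha>" "0 < \<beta>" using a0 b by (auto simp: \<alpha>_def \<beta>_def)
  have pw: "\<alpha> powr p = a" "\<beta> powr r = b"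
    using a0 b pr by (auto simp: \<alpha>_def \<beta>_def powr_powr)
  define c d where "c = \<alpha> * \<beta> / (a * p)" and "d = \<alpha> * \<beta> / (b * r)"
  have cd: "0 \<le> c" "0 \<le> d" using pos a0 b pr by (auto simp: c_def d_def)
  have "(\<integral>\<^sup>+x. ennreal (u x * g x) \<partial>M)
      \<le> (\<integral>\<^sup>+x. ennreal c * ennreal (u x powr p) + ennreal d * ennreal (g x powr r) \<partial>M)"
  proof (rule nn_integral_mono)
    fix x assume x: "x \<in> space M"
    have "(u x / \<alpha>) * (g x / \<beta>) \<le> (u x / \<alpha>) powr p / p + (g x / \<beta>) powr r / r"
      using nonneg[OF x] pos pr by (intro Youngs_inequality) auto
    then have "u x * g x / (\<alpha> * \<beta>) \<le> (u x powr p / a) / p + (g x powr r / b) / r"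
      using nonneg[OF x] pos by (simp add: powr_divide pw)
    then have "u x * g x \<le> ((u x powr p / a) / p + (g x powr r / b) / r) * (\<alpha> * \<beta>)"
      using pos by (subst (asm) pos_divide_le_eq) auto
    also have "\<dots> = c * u x powr p + d * g x powr r"
      by (simp add: c_def d_def field_simps)
    finally show "ennreal (u x * g x)
        \<le> ennreal c * ennreal (u x powr p) + ennreal d * ennreal (g x powr r)"
      using cd by (simp flip: ennreal_mult ennreal_plus)
  qed
  also have "\<dots> = ennreal c * (\<integral>\<^sup>+x. ennreal (u x powr p) \<partial>M)
      + ennreal d * (\<integral>\<^sup>+x. ennreal (g x powr r) \<partial>M)"
    by (simp add: nn_integral_add nn_integral_cmult)
  also have "\<dots> \<le> ennreal c * ennreal a + ennreal d * ennreal b"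
    using a b by (intro add_mono mult_left_mono) auto
  also have "\<dots> = ennreal (c * a + d * b)"
    using cd a b by (simp add: ennreal_mult ennreal_plus)
  also have "c * a + d * b = \<alpha> * \<beta> * (1 / p + 1 / r)"
    using a0 b pr by (simp add: c_def d_def field_simps)
  also have "\<dots> = \<alpha> * \<beta>" using pr by simp
  finally show ?thesis by (simp add: \<alpha>_def \<beta>_def)
qed

text \<open>Hoelder's inequality for the factorisation \<open>|f| = (|f w| h) * (|1/w| / h)\<close>. The free factor \<open>h\<close> is what
  allows mass to be shifted between the two integrals.\<close>

lemma weighted_Holder:
  fixes f w h :: "'a \<Rightarrow> real"
  assumes [measurable]: "f \<in> borel_measurable M" "w \<in> borel_measurable M" "h \<in> borel_measurable M"
    and R[measurable]: "Measurable.pred M (\<lambda>z. z \<in> R)"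
    and h: "\<And>z. 0 < h z" and w: "AE z in M. w z \<noteq> 0"
    and pr: "1 < p" "1 < r" "1 / p + 1 / r = (1::real)"
    and a: "0 \<le> a" "(\<integral>\<^sup>+z\<in>R. ennreal ((\<bar>f z * w z\<bar> * h z) powr p) \<partial>M) \<le> ennreal a"
    and b: "0 < b" "(\<integral>\<^sup>+z\<in>R. ennreal ((\<bar>1 / w z\<bar> / h z) powr r) \<partial>M) \<le> ennreal b"
  shows "(\<integral>\<^sup>+z\<in>R. ennreal \<bar>f z\<bar> \<partial>M) \<le> ennreal (a powr (1 / p) * b powr (1 / r))"
proof -
  define u where "u = (\<lambda>z. if z \<in> R then \<bar>f z * w z\<bar> * h z else 0)"
  define g where "g = (\<lambda>z. if z \<in> R then \<bar>1 / w z\<bar> / h z else 0)"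
  have [measurable]: "u \<in> borel_measurable M" "g \<in> borel_measurable M"
    unfolding u_def g_def by measurable
  have "(\<integral>\<^sup>+z\<in>R. ennreal \<bar>f z\<bar> \<partial>M) = (\<integral>\<^sup>+z. ennreal (u z * g z) \<partial>M)"
  proof (rule nn_integral_cong_AE)
    show "AE z in M. ennreal \<bar>f z\<bar> * indicator R z = ennreal (u z * g z)"
      using w
    proof eventually_elim
      case (elim z)
      then show ?case
        using h[of z] by (auto simp: u_def g_def indicator_def abs_mult)
    qed
  qed
  also have "\<dots> \<le> ennreal (a powr (1 / p) * b powr (1 / r))"
  proof (rule nn_integral_Holder)
    have "(\<integral>\<^sup>+z. ennreal (u z powr p) \<partial>M) = (\<integral>\<^sup>+z\<in>R. ennreal ((\<bar>f z * w z\<bar> * h z) powr p) \<partial>M)"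
      by (intro nn_integral_cong) (auto simp: u_def indicator_def)
    then show "(\<integral>\<^sup>+z. ennreal (u z powr p) \<partial>M) \<le> ennreal a" using a by simp
    have "(\<integral>\<^sup>+z. ennreal (g z powr r) \<partial>M) = (\<integral>\<^sup>+z\<in>R. ennreal ((\<bar>1 / w z\<bar> / h z) powr r) \<partial>M)"
      by (intro nn_integral_cong) (auto simp: g_def indicator_def)
    then show "(\<integral>\<^sup>+z. ennreal (g z powr r) \<partial>M) \<le> ennreal b" using b by simp
    show "0 \<le> u x" "0 \<le> g x" for x
      using h[of x] by (auto simp: u_def g_def)
  qed (use pr a b in auto)
  finally show ?thesis .
qed


section \<open>Lebesgue integrals on the quadrant\<close>

lemma quadrant_borel [measurable]: "quadrant \<in> sets borel"
  unfolding quadrant_def by (intro borel_closed closed_Times) auto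

lemma measurable_lebesgue_on_if_borel:
  assumes "f \<in> borel \<rightarrow>\<^sub>M N"
  shows "f \<in> lebesgue_on S \<rightarrow>\<^sub>M N"
  using assms by (intro measurable_restrict_space1 measurable_completion) simp

text \<open>Functions given on a subset only are turned into measurable functions on the whole space by cutting
  them off; here for extended nonnegative values, and below for real values.\<close>

lemma borel_measurable_times_indicator_if_lebesgue_on:
  fixes g :: "'a :: euclidean_space \<Rightarrow> ennreal"
  assumes "g \<in> borel_measurable (lebesgue_on S)" "A \<subseteq> S" "A \<in> sets lebesgue"
  shows "(\<lambda>x. g x * indicator A x) \<in> borel_measurable lebesgue"
proof -
  have "g \<in> borel_measurable (lebesgue_on A)"
    by (rule measurable_restrict_mono[OF assms(1,2)])
  then show ?thesis
    using assms(3) by (subst (asm) borel_measurable_restrict_space_iff_ennreal) auto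
qed

lemma borel_measurable_indicator_scaleR_if_lebesgue_on:
  fixes g :: "'a :: euclidean_space \<Rightarrow> real"
  assumes "g \<in> borel_measurable (lebesgue_on S)" "A \<subseteq> S" "A \<in> sets lebesgue"
  shows "(\<lambda>x. indicator A x *\<^sub>R g x) \<in> borel_measurable lebesgue"
proof -
  have "g \<in> borel_measurable (lebesgue_on A)"
    by (rule measurable_restrict_mono[OF assms(1,2)])
  then show ?thesis
    using assms(3) by (subst (asm) borel_measurable_restrict_space_iff) auto
qed

lemma set_integrable_if_nn_integral_finite:
  fixes f :: "'a :: euclidean_space \<Rightarrow> real"
  assumes f: "f \<in> borel_measurable (lebesgue_on S)" and A: "A \<subseteq> S" "A \<in> sets lebesgue"
    and fin: "(\<integral>\<^sup>+z\<in>A. ennreal \<bar>f z\<bar> \<partial>lebesgue) < \<infinity>"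
  shows "set_integrable lebesgue A f"
  unfolding set_integrable_def
proof (rule integrableI_bounded)
  show "(\<lambda>x. indicator A x *\<^sub>R f x) \<in> borel_measurable lebesgue"
    using f A by (rule borel_measurable_indicator_scaleR_if_lebesgue_on)
  have "(\<integral>\<^sup>+x. ennreal (norm (indicator A x *\<^sub>R f x)) \<partial>lebesgue) = (\<integral>\<^sup>+z\<in>A. ennreal \<bar>f z\<bar> \<partial>lebesgue)"
    by (intro nn_integral_cong) (auto simp: indicator_def)
  then show "(\<integral>\<^sup>+x. ennreal (norm (indicator A x *\<^sub>R f x)) \<partial>lebesgue) < \<infinity>" using fin by simp
qed

lemma AE_off_axes: "AE z in lebesgue. fst z \<noteq> (0::real) \<and> snd z \<noteq> (0::real)"
proof -
  have "{0} \<times> UNIV \<in> null_sets ((lborel :: real measure) \<Otimes>\<^sub>M (lborel :: real measure))"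
    "UNIV \<times> {0} \<in> null_sets ((lborel :: real measure) \<Otimes>\<^sub>M (lborel :: real measure))"
    by (auto simp: null_sets_def lborel.emeasure_pair_measure_Times)
  then have "{0} \<times> UNIV \<union> UNIV \<times> {0} \<in> null_sets ((lborel :: real measure) \<Otimes>\<^sub>M (lborel :: real measure))"
    by (rule null_sets.Un)
  then have "AE z in lborel \<Otimes>\<^sub>M lborel. fst z \<noteq> (0::real) \<and> snd z \<noteq> (0::real)"
    by (rule AE_I') auto
  then show ?thesis by (simp only: lborel_prod AE_completion_iff)
qed

text \<open>The axes are null sets, and on the open quadrant the primitives of the one-dimensional weights are
  positive, so that their levels make sense.\<close>

lemma nn_integral_quadrant_interior:
  "(\<integral>\<^sup>+z. g z \<partial>lebesgue_on quadrant) = (\<integral>\<^sup>+z. g z \<partial>lebesgue_on ({0<..} \<times> {0<..}))"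
proof -
  have "(\<integral>\<^sup>+z. g z * indicator quadrant z \<partial>lebesgue) = (\<integral>\<^sup>+z. g z * indicator ({0<..} \<times> {0<..}) z \<partial>lebesgue)"
  proof (rule nn_integral_cong_AE)
    show "AE z in lebesgue. g z * indicator quadrant z = g z * indicator ({0<..} \<times> {0<..}) z"
      using AE_off_axes by eventually_elim (auto simp: quadrant_def indicator_def)
  qed
  then show ?thesis by (simp add: nn_integral_restrict_space borel_Times)
qed

text \<open>Lebesgue measure on the plane is the completion of a product measure, not a product measure.
  Replacing the factors by almost everywhere equal Borel functions changes the integrand only on a union of
  null strips, after which Tonelli's theorem applies.\<close>

lemma nn_integral_lebesgue_times:
  fixes u1 u2 :: "real \<Rightarrow> ennreal"
  assumes "u1 \<in> borel_measurable lebesgue" "u2 \<in> borel_measurable lebesgue"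
  shows "(\<integral>\<^sup>+z. u1 (fst z) * u2 (snd z) \<partial>lebesgue)
    = (\<integral>\<^sup>+x. u1 x \<partial>lebesgue) * (\<integral>\<^sup>+y. u2 y \<partial>lebesgue)"
proof -
  obtain g1 where g1[measurable]: "g1 \<in> borel_measurable lborel" and e1: "AE x in lborel. u1 x = g1 x"
    using completion_ex_borel_measurable[OF assms(1)] by auto
  obtain g2 where g2[measurable]: "g2 \<in> borel_measurable lborel" and e2: "AE x in lborel. u2 x = g2 x"
    using completion_ex_borel_measurable[OF assms(2)] by auto
  obtain N1 where N1: "{x. u1 x \<noteq> g1 x} \<subseteq> N1" "emeasure lborel N1 = 0" "N1 \<in> sets lborel"
    using AE_E[OF e1] by auto
  obtain N2 where N2: "{x. u2 x \<noteq> g2 x} \<subseteq> N2" "emeasure lborel N2 = 0" "N2 \<in> sets lborel"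
    using AE_E[OF e2] by auto
  have "N1 \<times> UNIV \<in> null_sets (lborel \<Otimes>\<^sub>M lborel)" "UNIV \<times> N2 \<in> null_sets (lborel \<Otimes>\<^sub>M lborel)"
    using N1 N2 by (auto simp: null_sets_def lborel.emeasure_pair_measure_Times)
  then have "N1 \<times> UNIV \<union> UNIV \<times> N2 \<in> null_sets (lborel \<Otimes>\<^sub>M lborel)"
    by (rule null_sets.Un)
  then have ae: "AE z in lborel \<Otimes>\<^sub>M lborel. u1 (fst z) * u2 (snd z) = g1 (fst z) * g2 (snd z)"
  proof (rule AE_I')
    have "u1 x = g1 x" if "x \<notin> N1" for x using N1(1) that by auto
    moreover have "u2 x = g2 x" if "x \<notin> N2" for x using N2(1) that by auto
    ultimately show "{z \<in> space (lborel \<Otimes>\<^sub>M lborel). u1 (fst z) * u2 (snd z) \<noteq> g1 (fst z) * g2 (snd z)}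
        \<subseteq> N1 \<times> UNIV \<union> UNIV \<times> N2"
      by (intro subsetI, simp add: mem_Times_iff, metis)
  qed
  have "(\<integral>\<^sup>+z. u1 (fst z) * u2 (snd z) \<partial>lebesgue) = (\<integral>\<^sup>+z. u1 (fst z) * u2 (snd z) \<partial>(lborel \<Otimes>\<^sub>M lborel))"
    by (simp add: nn_integral_completion lborel_prod)
  also have "\<dots> = (\<integral>\<^sup>+z. g1 (fst z) * g2 (snd z) \<partial>(lborel \<Otimes>\<^sub>M lborel))"
    by (rule nn_integral_cong_AE[OF ae])
  also have "\<dots> = (\<integral>\<^sup>+x. \<integral>\<^sup>+y. g1 x * g2 y \<partial>lborel \<partial>lborel)"
    by (subst lborel.nn_integral_fst[symmetric]) auto
  also have "\<dots> = (\<integral>\<^sup>+x. g1 x \<partial>lborel) * (\<integral>\<^sup>+y. g2 y \<partial>lborel)"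
    by (simp add: nn_integral_cmult nn_integral_multc)
  also have "\<dots> = (\<integral>\<^sup>+x. u1 x \<partial>lborel) * (\<integral>\<^sup>+y. u2 y \<partial>lborel)"
    using nn_integral_cong_AE[OF e1] nn_integral_cong_AE[OF e2] by simp
  finally show ?thesis by (simp add: nn_integral_completion)
qed

text \<open>The separation of variables behind the role of product weights. With \<open>k1 = k2 = 1\<close> it computes the
  dual norm over a rectangle; with powers of 2 it gives the dual factor in Hoelder's inequality.\<close>

lemma nn_integral_product_weight:
  fixes k1 k2 :: "real \<Rightarrow> real"
  assumes w1: "w1 \<in> borel_measurable (lebesgue_on {0..})" and w2: "w2 \<in> borel_measurable (lebesgue_on {0..})"
    and w: "\<And>x y. 0 \<le> x \<Longrightarrow> 0 \<le> y \<Longrightarrow> w (x, y) = w1 x * w2 y"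
    and k: "k1 \<in> borel_measurable borel" "k2 \<in> borel_measurable borel" "\<And>x. 0 \<le> k1 x" "\<And>x. 0 \<le> k2 x"
    and X: "X \<subseteq> {0..}" "X \<in> sets borel" and Y: "Y \<subseteq> {0..}" "Y \<in> sets borel"
  shows "(\<integral>\<^sup>+z\<in>X \<times> Y. ennreal (\<bar>1 / w z\<bar> powr r * (k1 (fst z) * k2 (snd z))) \<partial>lebesgue)
    = (\<integral>\<^sup>+x\<in>X. ennreal (k1 x * \<bar>1 / w1 x\<bar> powr r) \<partial>lebesgue)
      * (\<integral>\<^sup>+y\<in>Y. ennreal (k2 y * \<bar>1 / w2 y\<bar> powr r) \<partial>lebesgue)"
proof -
  have "(\<integral>\<^sup>+z\<in>X \<times> Y. ennreal (\<bar>1 / w z\<bar> powr r * (k1 (fst z) * k2 (snd z))) \<partial>lebesgue)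
    = (\<integral>\<^sup>+z. (ennreal (k1 (fst z) * \<bar>1 / w1 (fst z)\<bar> powr r) * indicator X (fst z)) *
        (ennreal (k2 (snd z) * \<bar>1 / w2 (snd z)\<bar> powr r) * indicator Y (snd z)) \<partial>lebesgue)"
  proof (rule nn_integral_cong)
    fix z :: "real \<times> real"
    show "ennreal (\<bar>1 / w z\<bar> powr r * (k1 (fst z) * k2 (snd z))) * indicator (X \<times> Y) z
      = (ennreal (k1 (fst z) * \<bar>1 / w1 (fst z)\<bar> powr r) * indicator X (fst z)) *
        (ennreal (k2 (snd z) * \<bar>1 / w2 (snd z)\<bar> powr r) * indicator Y (snd z))"
    proof (cases "z \<in> X \<times> Y")
      case True
      then obtain x y where z: "z = (x, y)" "x \<in> X" "y \<in> Y" by auto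
      then have "w z = w1 x * w2 y" using w X(1) Y(1) by auto
      then have "\<bar>1 / w z\<bar> powr r = \<bar>1 / w1 x\<bar> powr r * \<bar>1 / w2 y\<bar> powr r"
        by (simp add: abs_mult powr_mult powr_divide)
      then show ?thesis using z k(3)[of x] k(4)[of y]
        by (simp add: mult_ac flip: ennreal_mult)
    qed (auto simp: indicator_def mem_Times_iff)
  qed
  also have "\<dots> = (\<integral>\<^sup>+x\<in>X. ennreal (k1 x * \<bar>1 / w1 x\<bar> powr r) \<partial>lebesgue)
      * (\<integral>\<^sup>+y\<in>Y. ennreal (k2 y * \<bar>1 / w2 y\<bar> powr r) \<partial>lebesgue)"
  proof (rule nn_integral_lebesgue_times)
    note [measurable] = w1 w2 measurable_lebesgue_on_if_borel[OF k(1), of "{0..}"]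
      measurable_lebesgue_on_if_borel[OF k(2), of "{0..}"]
    have "(\<lambda>x. ennreal (k1 x * \<bar>1 / w1 x\<bar> powr r)) \<in> borel_measurable (lebesgue_on {0..})" by measurable
    then show "(\<lambda>x. ennreal (k1 x * \<bar>1 / w1 x\<bar> powr r) * indicator X x) \<in> borel_measurable lebesgue"
      by (rule borel_measurable_times_indicator_if_lebesgue_on) (use X in auto)
    have "(\<lambda>x. ennreal (k2 x * \<bar>1 / w2 x\<bar> powr r)) \<in> borel_measurable (lebesgue_on {0..})" by measurable
    then show "(\<lambda>x. ennreal (k2 x * \<bar>1 / w2 x\<bar> powr r) * indicator Y x) \<in> borel_measurable lebesgue"
      by (rule borel_measurable_times_indicator_if_lebesgue_on) (use Y in auto)
  qed
  finally show ?thesis .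
qed

lemma nn_integral_powr_weight_pos:
  assumes u: "weight_on {0..} u" and a: "0 < (a::real)"
  shows "0 < (\<integral>\<^sup>+x\<in>{0..<a}. ennreal (\<bar>1 / u x\<bar> powr r) \<partial>lebesgue)"
proof (rule ccontr)
  assume "\<not> ?thesis"
  then have 0: "(\<integral>\<^sup>+x. ennreal (\<bar>1 / u x\<bar> powr r) * indicator {0..<a} x \<partial>lebesgue) = 0" by simp
  have [measurable]: "u \<in> borel_measurable (lebesgue_on {0..})" using u by (simp add: weight_on_def)
  have "(\<lambda>x. ennreal (\<bar>1 / u x\<bar> powr r)) \<in> borel_measurable (lebesgue_on {0..})" by measurable
  then have m: "(\<lambda>x. ennreal (\<bar>1 / u x\<bar> powr r) * indicator {0..<a} x) \<in> borel_measurable lebesgue"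
    by (rule borel_measurable_times_indicator_if_lebesgue_on) auto
  have "AE x in lebesgue. ennreal (\<bar>1 / u x\<bar> powr r) * indicator {0..<a} x = 0"
    using 0 by (simp only: nn_integral_0_iff_AE[OF m])
  moreover have "AE x in lebesgue. x \<in> {0..} \<longrightarrow> 0 < u x"
    using u by (simp add: weight_on_def AE_restrict_space_iff)
  ultimately have "AE x in lebesgue. x \<notin> {0..<a}"
    by eventually_elim (auto simp: indicator_def split: if_splits)
  then have "AE x in lborel. x \<notin> {0..<a}" by (simp only: AE_completion_iff)
  then have "emeasure lborel {0..<a} = 0"
    by (subst (asm) AE_iff_null_sets[symmetric]) (auto simp: null_sets_def)
  then show False using a by simp
qed

text \<open>The Bochner integral is 0 when \<open>f\<close> is not integrable, so the estimate holds for every \<open>f\<close>.\<close>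

lemma abs_hardy2_le:
  "ennreal \<bar>hardy2 f (x, y)\<bar> \<le> (\<integral>\<^sup>+z\<in>{0..x} \<times> {0..y}. ennreal \<bar>f z\<bar> \<partial>lebesgue)"
proof (cases "set_integrable lebesgue ({0..x} \<times> {0..y}) f")
  case True
  then have "ennreal (norm (LINT z|lebesgue. indicator ({0..x} \<times> {0..y}) z *\<^sub>R f z)) \<le> (\<integral>\<^sup>+z. ennreal (norm (indicator ({0..x} \<times> {0..y}) z *\<^sub>R f z)) \<partial>lebesgue)"
    unfolding set_integrable_def by (rule integral_norm_bound_ennreal)
  also have "\<dots> = (\<integral>\<^sup>+z\<in>{0..x} \<times> {0..y}. ennreal \<bar>f z\<bar> \<partial>lebesgue)"
    by (intro nn_integral_cong) (auto simp: indicator_def)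
  finally show ?thesis by (simp add: hardy2_def set_lebesgue_integral_def)
next
  case False
  then show ?thesis
    by (simp add: hardy2_def set_lebesgue_integral_def set_integrable_def not_integrable_integral_eq)
qed

lemma hardy2_scale: "hardy2 (\<lambda>z. f z / l) z = hardy2 f z / l"
  by (cases z) (simp add: hardy2_def)


section \<open>Dyadic levels of a one-dimensional weight\<close>

text \<open>The extended integrals over \<open>[0,a)\<close> are the values of a real primitive, which makes the continuity of the
  Henstock--Kurzweil primitive available.\<close>

lemma primitive_facts:
  fixes s :: "real \<Rightarrow> real"
  assumes sm: "s \<in> borel_measurable (lebesgue_on {0..})"
    and s0: "\<And>x. 0 \<le> x \<Longrightarrow> 0 \<le> s x"
    and fin: "\<And>a. 0 < a \<Longrightarrow> (\<integral>\<^sup>+x\<in>{0..<a}. ennreal (s x) \<partial>lebesgue) < \<infinity>"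
  defines "S \<equiv> \<lambda>x. integral {0..x} s"
  shows primitive_eq: "\<And>a. ennreal (S a) = (\<integral>\<^sup>+x\<in>{0..<a}. ennreal (s x) \<partial>lebesgue)"
    and primitive_nonneg: "\<And>a. 0 \<le> S a"
    and primitive_mono: "mono S"
    and primitive_continuous: "\<And>a. continuous_on {0..a} S"
proof -
  have m: "(\<lambda>x. indicator {0..} x *\<^sub>R s x) \<in> borel_measurable lebesgue"
    using sm by (subst (asm) borel_measurable_restrict_space_iff) auto
  have nn: "(\<integral>\<^sup>+x\<in>{0..a}. ennreal (s x) \<partial>lebesgue) = (\<integral>\<^sup>+x\<in>{0..<a}. ennreal (s x) \<partial>lebesgue)" for a
  proof (rule nn_integral_cong_AE)
    have "AE x in lebesgue. x \<noteq> a" by (intro AE_completion AE_lborel_singleton)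
    then show "AE x in lebesgue. ennreal (s x) * indicator {0..a} x = ennreal (s x) * indicator {0..<a} x"
      by eventually_elim (auto simp: indicator_def)
  qed
  have int: "set_integrable lebesgue {0..a} s" for a
    unfolding set_integrable_def
  proof (rule integrableI_bounded)
    have "(\<lambda>x. indicator {0..a} x *\<^sub>R s x) = (\<lambda>x. indicator {0..a} x *\<^sub>R (indicator {0..} x *\<^sub>R s x))"
      by (auto simp: indicator_def)
    also have "\<dots> \<in> borel_measurable lebesgue"
      by (rule borel_measurable_scaleR[OF _ m]) (auto intro!: borel_measurable_indicator)
    finally show "(\<lambda>x. indicator {0..a} x *\<^sub>R s x) \<in> borel_measurable lebesgue" .
    have "(\<integral>\<^sup>+ x. ennreal (norm (indicator {0..a} x *\<^sub>R s x)) \<partial>lebesgue)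
        = (\<integral>\<^sup>+x\<in>{0..a}. ennreal (s x) \<partial>lebesgue)"
      using s0 by (intro nn_integral_cong) (auto simp: indicator_def)
    also have "\<dots> < \<infinity>"
      using fin[of a] by (cases "0 < a") (auto simp: nn)
    finally show "(\<integral>\<^sup>+ x. ennreal (norm (indicator {0..a} x *\<^sub>R s x)) \<partial>lebesgue) < \<infinity>" .
  qed
  show eq: "ennreal (S a) = (\<integral>\<^sup>+x\<in>{0..<a}. ennreal (s x) \<partial>lebesgue)" for a
  proof -
    have "S a = (LINT x:{0..a}|lebesgue. s x)"
      using set_lebesgue_integral_eq_integral(2)[OF int] by (simp add: S_def)
    also have "ennreal \<dots> = (\<integral>\<^sup>+x. ennreal (indicator {0..a} x *\<^sub>R s x) \<partial>lebesgue)"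
      using int[of a] s0 unfolding set_lebesgue_integral_def set_integrable_def
      by (intro nn_integral_eq_integral[symmetric]) (auto simp: indicator_def)
    also have "\<dots> = (\<integral>\<^sup>+x\<in>{0..a}. ennreal (s x) \<partial>lebesgue)"
      by (intro nn_integral_cong) (auto simp: indicator_def)
    finally show ?thesis by (simp add: nn)
  qed
  show nonneg: "0 \<le> S a" for a
    unfolding S_def using s0 by (intro integral_nonneg set_lebesgue_integral_eq_integral(1)[OF int]) simp
  show "mono S"
  proof
    fix a b :: real assume "a \<le> b"
    then have "ennreal (S a) \<le> ennreal (S b)"
      unfolding eq by (intro nn_integral_mono) (auto simp: indicator_def)
    then show "S a \<le> S b" using nonneg by (simp add: ennreal_le_iff)
  qed
  show "continuous_on {0..a} S" for a
    unfolding S_def using set_lebesgue_integral_eq_integral(1)[OF int]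
    by (rule indefinite_integral_continuous_1)
qed

text \<open>Let \<open>S\<close> be the primitive of \<open>s\<close>; the level of \<open>x\<close> is the integer \<open>n x\<close> with
  \<open>4^(n x) \<le> S x < 4^(n x + 1)\<close>. The base is 4 so that \<open>S^(-1/2)\<close>, the weight
  in the dual integral of Hoelder's inequality, is comparable to an integral power of 2.

  Third property: the points of level \<open>k\<close> carry \<open>s\<close>-mass at most \<open>4^(k+1)\<close>, so the integral is
  bounded by the geometric sum of \<open>2^(-k) * 4^(k+1)\<close> over \<open>k \<le> i\<close>, which is \<open>8 * 2^i\<close>.

  Fourth property: \<open>a\<close> is the left endpoint of the level set of \<open>x\<close>. By continuity \<open>S a\<close> still
  reaches \<open>4^(n x)\<close>, and this also forces \<open>a > 0\<close>. The range of \<open>S\<close> may be bounded, so levels may be empty;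
  hence the property is stated for the levels of actual points.\<close>

lemma dyadic_levels:
  fixes s :: "real \<Rightarrow> real"
  assumes sm: "s \<in> borel_measurable (lebesgue_on {0..})"
    and s0: "\<And>x. 0 \<le> x \<Longrightarrow> 0 \<le> s x"
    and fin: "\<And>a. 0 < a \<Longrightarrow> (\<integral>\<^sup>+x\<in>{0..<a}. ennreal (s x) \<partial>lebesgue) < \<infinity>"
    and pos: "\<And>a. 0 < a \<Longrightarrow> 0 < (\<integral>\<^sup>+x\<in>{0..<a}. ennreal (s x) \<partial>lebesgue)"
  obtains n :: "real \<Rightarrow> int" where
    "n \<in> borel \<rightarrow>\<^sub>M count_space UNIV"
    "\<And>x y. 0 < x \<Longrightarrow> x \<le> y \<Longrightarrow> n x \<le> n y"
    "\<And>i. (\<integral>\<^sup>+x\<in>{x. 0 < x \<and> n x \<le> i}. ennreal (2 powr - n x * s x) \<partial>lebesgue)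
       \<le> ennreal (8 * 2 powr i)"
    "\<And>x. 0 < x \<Longrightarrow> \<exists>a>0. (\<forall>y>0. n y = n x \<longrightarrow> a \<le> y) \<and>
       ennreal (4 powr n x) \<le> (\<integral>\<^sup>+t\<in>{0..<a}. ennreal (s t) \<partial>lebesgue)"
proof
  define S where "S x = integral {0..x} s" for x
  have S_eq: "ennreal (S a) = (\<integral>\<^sup>+x\<in>{0..<a}. ennreal (s x) \<partial>lebesgue)" for a
    unfolding S_def using assms by (intro primitive_eq)
  have S_mono: "mono S"
    unfolding S_def using assms by (intro primitive_mono)
  have S_cont: "continuous_on {0..a} S" for a
    unfolding S_def using assms by (intro primitive_continuous)
  have S_pos: "0 < S x" if "0 < x" for x
    using pos[OF that] unfolding S_eq[symmetric] by simp
  have S_0: "S 0 = 0" by (simp add: S_def)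
  define n where "n = (\<lambda>x. \<lfloor>log 4 (S x)\<rfloor>)"
  have n_iff: "k \<le> n x \<longleftrightarrow> 4 powr k \<le> S x" if "0 < x" for x k
    using S_pos[OF that] by (simp add: n_def le_floor_iff le_log_iff)
  have m: "(\<lambda>x. indicator {0..} x *\<^sub>R s x) \<in> borel_measurable lebesgue"
    using sm by (subst (asm) borel_measurable_restrict_space_iff) auto
  have S_borel[measurable]: "S \<in> borel_measurable borel"
    by (rule borel_measurable_mono[OF S_mono])
  show n_meas[measurable]: "n \<in> borel \<rightarrow>\<^sub>M count_space UNIV"
    unfolding n_def by measurable
  show n_mono: "n x \<le> n y" if "0 < x" "x \<le> y" for x y
    using S_pos[OF that(1)] monoD[OF S_mono that(2)] unfolding n_def
    by (intro floor_mono) simp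
  show "\<exists>a>0. (\<forall>y>0. n y = n x \<longrightarrow> a \<le> y) \<and>
       ennreal (4 powr n x) \<le> (\<integral>\<^sup>+t\<in>{0..<a}. ennreal (s t) \<partial>lebesgue)" if x: "0 < x" for x
  proof -
    \<comment> \<open>\<open>S\<close> is constant where \<open>s\<close> vanishes, so \<open>4^(n x)\<close> may have many preimages; the least is wanted.\<close>
    let ?C = "{a \<in> {0..x}. 4 powr n x \<le> S a}"
    have "closed ?C"
      by (intro continuous_on_closed_Collect_le S_cont continuous_intros) auto
    then have "compact ?C"
      using compact_Int_closed[of "{0..x}" ?C] by (simp add: Int_def conj_ac)
    moreover have "x \<in> ?C" using x n_iff[OF x] by auto
    ultimately obtain a where a: "a \<in> ?C" "\<And>y. y \<in> ?C \<Longrightarrow> a \<le> y"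
      using compact_attains_inf[of ?C] by blast
    have "a \<noteq> 0" using a(1) S_0 by auto
    then have "0 < a" using a(1) by auto
    moreover have "a \<le> y" if y: "0 < y" "n y = n x" for y
    proof (rule ccontr)
      assume "\<not> a \<le> y"
      then have "y \<in> ?C" using n_iff[OF y(1), of "n x"] y a(1) by auto
      with a(2) \<open>\<not> a \<le> y\<close> show False by auto
    qed
    moreover have "ennreal (4 powr n x) \<le> (\<integral>\<^sup>+t\<in>{0..<a}. ennreal (s t) \<partial>lebesgue)"
      unfolding S_eq[symmetric] using a(1) by (auto intro: ennreal_leI)
    ultimately show ?thesis by blast
  qed
  \<comment> \<open>Either \<open>S\<close> attains \<open>M\<close>, and the sublevel set lies left of such a point, or \<open>S < M\<close> everywhere.\<close>
  have below: "(\<integral>\<^sup>+x\<in>{x. 0 < x \<and> S x < M}. ennreal (s x) \<partial>lebesgue) \<le> ennreal M" if M: "0 < M" for M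
  proof (cases "\<exists>b\<ge>0. M \<le> S b")
    case True
    then obtain b where b: "0 \<le> b" "M \<le> S b" by blast
    obtain c where c: "0 \<le> c" "c \<le> b" "S c = M"
      using IVT'[of S 0 M b] S_cont[of b] b M S_0 by auto
    have "x < c" if "S x < M" for x
      using monoD[OF S_mono, of c x] that c(3) by (cases "x < c") auto
    then have "(\<integral>\<^sup>+x\<in>{x. 0 < x \<and> S x < M}. ennreal (s x) \<partial>lebesgue)
        \<le> (\<integral>\<^sup>+x\<in>{0..<c}. ennreal (s x) \<partial>lebesgue)"
      by (intro nn_integral_mono) (auto simp: indicator_def)
    then show ?thesis by (simp flip: S_eq add: c(3))
  next
    case False
    have "(\<integral>\<^sup>+x\<in>{x. 0 < x \<and> S x < M}. ennreal (s x) \<partial>lebesgue)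
        \<le> (\<integral>\<^sup>+x. (SUP k. ennreal (indicator {0..} x *\<^sub>R s x) * indicator {0..<real k} x) \<partial>lebesgue)"
    proof (rule nn_integral_mono)
      fix x :: real
      obtain k where "x < real k" using reals_Archimedean2 by blast
      then have "ennreal (s x) * indicator {x. 0 < x \<and> S x < M} x
          \<le> ennreal (indicator {0..} x *\<^sub>R s x) * indicator {0..<real k} x"
        by (auto simp: indicator_def)
      also have "\<dots> \<le> (SUP k. ennreal (indicator {0..} x *\<^sub>R s x) * indicator {0..<real k} x)"
        by (rule SUP_upper) simp
      finally show "ennreal (s x) * indicator {x. 0 < x \<and> S x < M} x
          \<le> (SUP k. ennreal (indicator {0..} x *\<^sub>R s x) * indicator {0..<real k} x)" .
    qed
    also have "\<dots> = (SUP k. \<integral>\<^sup>+x. ennreal (indicator {0..} x *\<^sub>R s x) * indicator {0..<real k} x \<partial>lebesgue)"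
    proof (rule nn_integral_monotone_convergence_SUP)
      show "incseq (\<lambda>k x. ennreal (indicator {0..} x *\<^sub>R s x) * indicator {0..<real k} x)"
        by (auto simp: incseq_def le_fun_def indicator_def)
      show "(\<lambda>x. ennreal (indicator {0..} x *\<^sub>R s x) * indicator {0..<real k} x)
          \<in> borel_measurable lebesgue" for k
        using m by (intro borel_measurable_times_ennreal measurable_compose[OF m measurable_ennreal]
            borel_measurable_indicator) auto
    qed
    also have "\<dots> \<le> ennreal M"
    proof (rule SUP_least)
      fix k :: nat
      have "(\<integral>\<^sup>+x. ennreal (indicator {0..} x *\<^sub>R s x) * indicator {0..<real k} x \<partial>lebesgue)
          = (\<integral>\<^sup>+x\<in>{0..<real k}. ennreal (s x) \<partial>lebesgue)"
        by (intro nn_integral_cong) (auto simp: indicator_def)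
      also have "\<dots> \<le> ennreal M"
        unfolding S_eq[symmetric] using False by (intro ennreal_leI) (metis nle_le of_nat_0_le_iff)
      finally show "(\<integral>\<^sup>+x. ennreal (indicator {0..} x *\<^sub>R s x) * indicator {0..<real k} x \<partial>lebesgue)
          \<le> ennreal M" .
    qed
    finally show ?thesis .
  qed
  show "(\<integral>\<^sup>+x\<in>{x. 0 < x \<and> n x \<le> i}. ennreal (2 powr - n x * s x) \<partial>lebesgue)
       \<le> ennreal (8 * 2 powr i)" for i
  proof -
    \<comment> \<open>Level \<open>i - m\<close> is listed by \<open>m\<close>, so that all levels up to \<open>i\<close> form a series over the naturals.\<close>
    let ?f = "\<lambda>(m::nat) x. ennreal (2 powr (m - i)) * (ennreal (indicator {0..} x *\<^sub>R s x) * indicator {x. 0 < x \<and> n x = i - int m} x)"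
    have level: "{x. 0 < x \<and> n x = k} \<in> sets lebesgue" for k
    proof -
      have "{x. 0 < x \<and> n x = k} \<in> sets borel" by measurable
      then show ?thesis by simp
    qed
    have fm: "?f m \<in> borel_measurable lebesgue" for m
      by (intro borel_measurable_times_ennreal measurable_compose[OF m measurable_ennreal]
            borel_measurable_indicator level) auto
    have "(\<integral>\<^sup>+x\<in>{x. 0 < x \<and> n x \<le> i}. ennreal (2 powr - n x * s x) \<partial>lebesgue)
        \<le> (\<integral>\<^sup>+x. (\<Sum>m. ?f m x) \<partial>lebesgue)"
    proof (rule nn_integral_mono)
      fix x
      define m where "m = nat (i - n x)"
      have "ennreal (2 powr - n x * s x) * indicator {x. 0 < x \<and> n x \<le> i} x \<le> ?f m x"
        by (auto simp: indicator_def m_def ennreal_mult' s0)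
      also have "\<dots> \<le> (\<Sum>m. ?f m x)"
        using sum_le_suminf[of "\<lambda>m. ?f m x" "{m}"] by simp
      finally show "ennreal (2 powr - n x * s x) * indicator {x. 0 < x \<and> n x \<le> i} x \<le> (\<Sum>m. ?f m x)" .
    qed
    also have "\<dots> = (\<Sum>m. \<integral>\<^sup>+x. ?f m x \<partial>lebesgue)"
      by (rule nn_integral_suminf[OF fm])
    also have "\<dots> \<le> (\<Sum>m. ennreal (4 * 2 powr i * (1 / 2) ^ m))"
    proof (intro suminf_le summableI)
      fix m :: nat
      have "(\<integral>\<^sup>+x. ?f m x \<partial>lebesgue) = ennreal (2 powr (m - i)) *
          (\<integral>\<^sup>+x. ennreal (indicator {0..} x *\<^sub>R s x) * indicator {x. 0 < x \<and> n x = i - int m} x \<partial>lebesgue)"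
        by (intro nn_integral_cmult borel_measurable_times_ennreal measurable_compose[OF m measurable_ennreal]
            borel_measurable_indicator level)
      also have "(\<integral>\<^sup>+x. ennreal (indicator {0..} x *\<^sub>R s x) * indicator {x. 0 < x \<and> n x = i - int m} x \<partial>lebesgue)
          \<le> (\<integral>\<^sup>+x\<in>{x. 0 < x \<and> S x < 4 powr (i - int m + 1)}. ennreal (s x) \<partial>lebesgue)"
      proof (rule nn_integral_mono)
        fix x
        have "S x < 4 powr (i - int m + 1)" if "0 < x" "n x = i - int m"
          using n_iff[OF that(1), of "i - int m + 1"] that(2) by auto
        then show "ennreal (indicator {0..} x *\<^sub>R s x) * indicator {x. 0 < x \<and> n x = i - int m} x
            \<le> ennreal (s x) * indicator {x. 0 < x \<and> S x < 4 powr (i - int m + 1)} x"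
          by (auto simp: indicator_def)
      qed
      also have "\<dots> \<le> ennreal (4 powr (i - int m + 1))" by (rule below) simp
      also have "ennreal (2 powr (m - i)) * ennreal (4 powr (i - int m + 1)) = ennreal (4 * 2 powr i * (1 / 2) ^ m)"
      proof -
        have "(4::real) powr (i - int m + 1) = (2 powr 2) powr (i - int m + 1)" by simp
        also have "\<dots> = 2 powr (2 * (i - int m + 1))" by (simp only: powr_powr) simp
        finally have "2 powr (m - i) * 4 powr (i - int m + 1) = (2::real) powr (m - i + 2 * (i - int m + 1))"
          by (simp only: powr_add[symmetric] of_int_add)
        also have "\<dots> = 2 powr (2 + real_of_int i - real m)" by (simp add: algebra_simps)
        also have "\<dots> = 2 powr 2 * 2 powr i / 2 powr real m"
          by (simp only: powr_add powr_diff)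
        also have "\<dots> = 4 * 2 powr i * (1 / 2) ^ m"
          by (simp add: powr_realpow power_one_over)
        finally show ?thesis by (simp flip: ennreal_mult)
      qed
      finally show "(\<integral>\<^sup>+x. ?f m x \<partial>lebesgue) \<le> ennreal (4 * 2 powr i * (1 / 2) ^ m)"
        by (simp add: mult_left_mono)
    qed
    also have "\<dots> = ennreal (8 * 2 powr i)"
    proof -
      have "(\<lambda>m. 4 * 2 powr i * (1 / 2) ^ m) sums (4 * 2 powr i * (1 / (1 - 1 / 2 :: real)))"
        by (intro sums_mult geometric_sums) simp
      then show ?thesis by (subst suminf_ennreal2) (auto simp: sums_iff)
    qed
    finally show ?thesis .
  qed
qed


section \<open>The discretised Hardy inequality\<close>

lemma nn_integral_geometric_int:
  fixes n :: int and e :: real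
  assumes e: "0 < e"
  shows "(\<integral>\<^sup>+i. (if n \<le> i then ennreal (2 powr (e * n - e * i)) else 0) \<partial>count_space (UNIV :: int set))
    = ennreal (1 / (1 - 2 powr - e))"
proof -
  have "(\<integral>\<^sup>+i. (if n \<le> i then ennreal (2 powr (e * n - e * i)) else 0) \<partial>count_space (UNIV :: int set))
      = (\<integral>\<^sup>+i. ennreal (2 powr (e * n - e * i)) \<partial>count_space {n..})"
    by (auto simp: nn_integral_count_space_indicator indicator_def intro!: nn_integral_cong)
  also have "\<dots> = (\<integral>\<^sup>+k. ennreal (2 powr (e * n - e * (n + int k))) \<partial>count_space UNIV)"
  proof (rule nn_integral_bij_count_space[symmetric])
    show "bij_betw (\<lambda>k. n + int k) UNIV {n..}"
      by (rule bij_betwI[where g = "\<lambda>i. nat (i - n)"]) auto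
  qed
  also have "\<dots> = (\<Sum>k. ennreal ((2 powr - e) ^ k))"
  proof (subst nn_integral_count_space_nat, rule suminf_cong)
    fix k :: nat
    have "(2 powr - e) ^ k = (2 powr - e) powr real k" by (simp add: powr_realpow)
    also have "\<dots> = 2 powr (e * n - e * (n + int k))" by (simp add: powr_powr algebra_simps)
    finally show "ennreal (2 powr (e * n - e * (n + int k))) = ennreal ((2 powr - e) ^ k)" by simp
  qed
  also have "\<dots> = ennreal (1 / (1 - 2 powr - e))"
  proof -
    have "\<bar>2 powr - e\<bar> < 1" using e powr_less_one[of 2 "- e"] by simp
    then have "(\<lambda>k. (2 powr - e) ^ k) sums (1 / (1 - 2 powr - e))"
      by (intro geometric_sums) simp
    then show ?thesis by (subst suminf_ennreal2) (auto simp: sums_iff)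
  qed
  finally show ?thesis .
qed

text \<open>After exchanging sum and integral, a point \<open>z\<close> contributes to the levels \<open>i \<ge> m1 z\<close> and \<open>j \<ge> m2 z\<close>
  with geometrically decaying weights.\<close>

lemma level_sum_le:
  fixes m1 m2 :: "'a \<Rightarrow> int" and e :: real
  assumes [measurable]: "m1 \<in> M \<rightarrow>\<^sub>M count_space UNIV" "m2 \<in> M \<rightarrow>\<^sub>M count_space UNIV"
    and \<phi>[measurable]: "\<phi> \<in> borel_measurable M" and e: "0 < e"
  shows "(\<integral>\<^sup>+i. \<integral>\<^sup>+j. (\<integral>\<^sup>+z\<in>{z. m1 z \<le> i \<and> m2 z \<le> j}. \<phi> z * ennreal (2 powr (e * (m1 z + m2 z))) \<partial>M)
        * ennreal (2 powr - (e * (i + j))) \<partial>count_space UNIV \<partial>count_space UNIV)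
    = ennreal ((1 / (1 - 2 powr - e))\<^sup>2) * (\<integral>\<^sup>+z. \<phi> z \<partial>M)"
proof -
  define K where "K = 1 / (1 - 2 powr - e)"
  have K0: "0 \<le> K" using e powr_less_one[of 2 "- e"] by (simp add: K_def)
  define F where "F m i = (if m \<le> i then ennreal (2 powr (e * m - e * i)) else 0)" for m i :: int
  have F: "(\<integral>\<^sup>+i. F m i \<partial>count_space UNIV) = ennreal K" for m
    unfolding F_def K_def by (rule nn_integral_geometric_int[OF e])
  have [measurable]: "(\<lambda>z. F (m1 z) i) \<in> borel_measurable M" "(\<lambda>z. F (m2 z) i) \<in> borel_measurable M" for i
    unfolding F_def by measurable
  have "(\<integral>\<^sup>+z\<in>{z. m1 z \<le> i \<and> m2 z \<le> j}. \<phi> z * ennreal (2 powr (e * (m1 z + m2 z))) \<partial>M)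
        * ennreal (2 powr - (e * (i + j))) = (\<integral>\<^sup>+z. \<phi> z * (F (m1 z) i * F (m2 z) j) \<partial>M)" for i j
  proof -
    have "(\<integral>\<^sup>+z. \<phi> z * (F (m1 z) i * F (m2 z) j) \<partial>M)
      = (\<integral>\<^sup>+z. (\<phi> z * ennreal (2 powr (e * (m1 z + m2 z))) * indicator {z. m1 z \<le> i \<and> m2 z \<le> j} z)
          * ennreal (2 powr - (e * (i + j))) \<partial>M)"
    proof (rule nn_integral_cong)
      fix z
      have "2 powr (e * m1 z - e * i) * 2 powr (e * m2 z - e * j)
          = 2 powr (e * (m1 z + m2 z)) * 2 powr - (e * (i + j))"
        by (simp add: algebra_simps flip: powr_add)
      then show "\<phi> z * (F (m1 z) i * F (m2 z) j)
          = (\<phi> z * ennreal (2 powr (e * (m1 z + m2 z))) * indicator {z. m1 z \<le> i \<and> m2 z \<le> j} z)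
          * ennreal (2 powr - (e * (i + j)))"
        by (simp add: F_def indicator_def mult.assoc flip: ennreal_mult)
    qed
    also have "\<dots> = (\<integral>\<^sup>+z\<in>{z. m1 z \<le> i \<and> m2 z \<le> j}. \<phi> z * ennreal (2 powr (e * (m1 z + m2 z))) \<partial>M)
        * ennreal (2 powr - (e * (i + j)))"
      by (rule nn_integral_multc) measurable
    finally show ?thesis by simp
  qed
  then have "(\<integral>\<^sup>+i. \<integral>\<^sup>+j. (\<integral>\<^sup>+z\<in>{z. m1 z \<le> i \<and> m2 z \<le> j}. \<phi> z * ennreal (2 powr (e * (m1 z + m2 z))) \<partial>M)
        * ennreal (2 powr - (e * (i + j))) \<partial>count_space UNIV \<partial>count_space UNIV)
      = (\<integral>\<^sup>+i. \<integral>\<^sup>+j. \<integral>\<^sup>+z. \<phi> z * (F (m1 z) i * F (m2 z) j) \<partial>M \<partial>count_space UNIV \<partial>count_space UNIV)"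
    by simp
  also have "\<dots> = (\<integral>\<^sup>+i. \<integral>\<^sup>+z. \<integral>\<^sup>+j. \<phi> z * (F (m1 z) i * F (m2 z) j) \<partial>count_space UNIV \<partial>M \<partial>count_space UNIV)"
    by (subst nn_integral_count_space_nn_integral) auto
  also have "\<dots> = (\<integral>\<^sup>+i. \<integral>\<^sup>+z. \<phi> z * F (m1 z) i * ennreal K \<partial>M \<partial>count_space UNIV)"
    by (simp add: nn_integral_cmult F mult.assoc)
  also have "\<dots> = (\<integral>\<^sup>+z. \<integral>\<^sup>+i. \<phi> z * F (m1 z) i * ennreal K \<partial>count_space UNIV \<partial>M)"
    by (subst nn_integral_count_space_nn_integral) auto
  also have "\<dots> = (\<integral>\<^sup>+z. \<phi> z * (ennreal K * ennreal K) \<partial>M)"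
    by (simp add: nn_integral_cmult nn_integral_multc F mult.assoc)
  also have "\<dots> = (\<integral>\<^sup>+z. \<phi> z \<partial>M) * (ennreal K * ennreal K)"
    by (rule nn_integral_multc) measurable
  also have "\<dots> = ennreal (K\<^sup>2) * (\<integral>\<^sup>+z. \<phi> z \<partial>M)"
    using K0 by (simp add: power2_eq_square mult.commute ennreal_mult)
  finally show ?thesis unfolding K_def .
qed

lemma borel_measurable_nn_integral_count_space_int:
  fixes g :: "int \<Rightarrow> 'a \<Rightarrow> ennreal"
  assumes [measurable]: "\<And>j. g j \<in> borel_measurable M"
  shows "(\<lambda>z. \<integral>\<^sup>+j. g j z \<partial>count_space UNIV) \<in> borel_measurable M"
proof -
  have "(\<integral>\<^sup>+j. g j z \<partial>count_space UNIV) = (\<Sum>k. g (int_decode k) z)" for z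
    using nn_integral_bij_count_space[OF bij_int_decode, of "\<lambda>j. g j z"]
    by (simp add: nn_integral_count_space_nat)
  then show ?thesis by simp
qed

text \<open>The Hardy inequality for two level functions \<open>m1\<close>, \<open>m2\<close> on an arbitrary measure space. Here \<open>H\<close> stands
  for the Hardy transform, of which only the bound by the integral of \<open>|f|\<close> over the lower levels matters;
  \<open>dual\<close> is the integral estimate for \<open>1/w\<close>, and \<open>tail\<close> is the form that the condition on \<open>v\<close> takes on a single block.

  Hoelder's inequality with factor \<open>2^((m1 + m2)/r)\<close> bounds the integral of \<open>|f|\<close> over the lower levels by
  \<open>T i j\<close>. Rescaled to \<open>t i j\<close>, these numbers satisfy \<open>\<Sum> t^p \<le> 1\<close> by
  \<open>level_sum_le\<close>; the constant \<open>c\<close> is chosen to make this bound exactly 1. In particular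
  each \<open>t i j\<close> is at most 1, and so \<open>t^q \<le> t^p\<close> although \<open>q\<close> varies.\<close>

lemma level_modular_bound:
  fixes m1 m2 :: "'a \<Rightarrow> int" and f w v q H :: "'a \<Rightarrow> real" and p r B c :: real
  assumes [measurable]: "m1 \<in> M \<rightarrow>\<^sub>M count_space UNIV" "m2 \<in> M \<rightarrow>\<^sub>M count_space UNIV"
    "f \<in> borel_measurable M" "w \<in> borel_measurable M" "v \<in> borel_measurable M" "q \<in> borel_measurable M"
    and w: "AE z in M. w z \<noteq> 0"
    and pr: "1 < p" "1 < r" "1 / p + 1 / r = 1"
    and q: "\<And>z. z \<in> space M \<Longrightarrow> p \<le> q z"
    and B: "0 < B"
    and dual: "\<And>i j. (\<integral>\<^sup>+z\<in>{z. m1 z \<le> i \<and> m2 z \<le> j}.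
        ennreal (\<bar>1 / w z\<bar> powr r * 2 powr - (m1 z + m2 z)) \<partial>M) \<le> ennreal (64 * 2 powr (i + j))"
    and tail: "\<And>i j. (\<integral>\<^sup>+z\<in>{z. m1 z = i \<and> m2 z = j}.
        ennreal (\<bar>v z * (4 powr ((i + j) / r) / B)\<bar> powr q z) \<partial>M) \<le> 1"
    and f: "(\<integral>\<^sup>+z. ennreal (\<bar>f z * w z\<bar> powr p) \<partial>M) \<le> 1"
    and H: "\<And>z. z \<in> space M \<Longrightarrow>
        ennreal \<bar>H z\<bar> \<le> (\<integral>\<^sup>+t\<in>{t. m1 t \<le> m1 z \<and> m2 t \<le> m2 z}. ennreal \<bar>f t\<bar> \<partial>M)"
  defines "c \<equiv> B * 64 powr (1 / r) * (1 / (1 - 2 powr - (p - 1))) powr (2 / p)"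
  shows "(\<integral>\<^sup>+z\<in>{z. m1 z \<le> i \<and> m2 z \<le> j}. ennreal \<bar>f z\<bar> \<partial>M) < \<infinity>"
    and "(\<integral>\<^sup>+z. ennreal (\<bar>H z * v z / c\<bar> powr q z) \<partial>M) \<le> 1"
proof -
  define K where "K = 1 / (1 - 2 powr - (p - 1))"
  have K: "0 < K" using pr powr_less_one[of 2 "- (p - 1)"] by (simp add: K_def)
  have ppr: "p / r = p - 1" using pr by (simp add: field_simps)
  have c_eq: "c = B * 64 powr (1 / r) * K powr (2 / p)" by (simp add: c_def K_def)
  then have c: "0 < c" using B K by simp
  define A where "A i j = (\<integral>\<^sup>+z\<in>{z. m1 z \<le> i \<and> m2 z \<le> j}.
      ennreal (\<bar>f z * w z\<bar> powr p) * ennreal (2 powr ((p - 1) * (m1 z + m2 z))) \<partial>M)" for i j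
  have sum_A: "(\<integral>\<^sup>+i. \<integral>\<^sup>+j. A i j * ennreal (2 powr - ((p - 1) * (i + j)))
      \<partial>count_space UNIV \<partial>count_space UNIV) \<le> ennreal (K\<^sup>2)"
  proof -
    have "(\<integral>\<^sup>+i. \<integral>\<^sup>+j. A i j * ennreal (2 powr - ((p - 1) * (i + j)))
      \<partial>count_space UNIV \<partial>count_space UNIV) = ennreal (K\<^sup>2) * (\<integral>\<^sup>+z. ennreal (\<bar>f z * w z\<bar> powr p) \<partial>M)"
      unfolding A_def K_def using pr by (intro level_sum_le) auto
    also have "\<dots> \<le> ennreal (K\<^sup>2) * 1" by (intro mult_left_mono f) simp
    finally show ?thesis by simp
  qed
  have A_le: "A i j * ennreal (2 powr - ((p - 1) * (i + j))) \<le> ennreal (K\<^sup>2)" for i j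
  proof -
    have "A i j * ennreal (2 powr - ((p - 1) * (i + j)))
        \<le> (\<integral>\<^sup>+j. A i j * ennreal (2 powr - ((p - 1) * (i + j))) \<partial>count_space UNIV)"
      by (rule nn_integral_ge_point[of j UNIV "\<lambda>j. A i j * ennreal (2 powr - ((p - 1) * (i + j)))"]) simp
    also have "\<dots> \<le> (\<integral>\<^sup>+i. \<integral>\<^sup>+j. A i j * ennreal (2 powr - ((p - 1) * (i + j))) \<partial>count_space UNIV \<partial>count_space UNIV)"
      by (rule nn_integral_ge_point[of i UNIV
            "\<lambda>i. \<integral>\<^sup>+j. A i j * ennreal (2 powr - ((p - 1) * (i + j))) \<partial>count_space UNIV"]) simp
    finally show ?thesis using sum_A by (rule order_trans)
  qed
  have A_fin: "A i j < top" for i j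
  proof (rule ccontr)
    assume "\<not> A i j < top"
    then have "A i j = top" by (metis less_top)
    with A_le[of i j] show False by (simp add: ennreal_top_mult top_unique)
  qed
  define a where "a i j = enn2real (A i j)" for i j
  have a: "A i j = ennreal (a i j)" "0 \<le> a i j" for i j
    using A_fin[of i j] by (simp_all add: a_def)
  define T where "T i j = a i j powr (1 / p) * (64 * 2 powr (i + j)) powr (1 / r)" for i j :: int
  have T0: "0 \<le> T i j" for i j by (simp add: T_def)
  have block: "(\<integral>\<^sup>+z\<in>{z. m1 z \<le> i \<and> m2 z \<le> j}. ennreal \<bar>f z\<bar> \<partial>M) \<le> ennreal (T i j)" for i j
    unfolding T_def
  proof (rule weighted_Holder[where w = w and h = "\<lambda>z. 2 powr ((m1 z + m2 z) / r)"])
    have "(2 powr ((m1 z + m2 z) / r)) powr p = 2 powr ((p - 1) * (m1 z + m2 z))" for z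
      using ppr by (simp add: powr_powr mult.commute flip: times_divide_eq_left)
    then have "(\<integral>\<^sup>+z\<in>{z. m1 z \<le> i \<and> m2 z \<le> j}. ennreal ((\<bar>f z * w z\<bar> * 2 powr ((m1 z + m2 z) / r)) powr p) \<partial>M) = A i j"
      unfolding A_def by (intro nn_integral_cong) (simp add: powr_mult ennreal_mult')
    then show "(\<integral>\<^sup>+z\<in>{z. m1 z \<le> i \<and> m2 z \<le> j}. ennreal ((\<bar>f z * w z\<bar> * 2 powr ((m1 z + m2 z) / r)) powr p) \<partial>M)
        \<le> ennreal (a i j)"
      by (simp add: a)
    have "(\<bar>1 / w z\<bar> / 2 powr (k / r)) powr r = \<bar>1 / w z\<bar> powr r * 2 powr - k" for z and k :: int
    proof -
      have "(\<bar>1 / w z\<bar> / 2 powr (k / r)) powr r = \<bar>1 / w z\<bar> powr r / (2 powr (k / r)) powr r"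
        by (rule powr_divide)
      also have "(2 powr (k / r)) powr r = 2 powr k" using pr by (simp add: powr_powr)
      finally show ?thesis by (simp add: powr_minus_divide)
    qed
    then have "(\<integral>\<^sup>+z\<in>{z. m1 z \<le> i \<and> m2 z \<le> j}. ennreal ((\<bar>1 / w z\<bar> / 2 powr ((m1 z + m2 z) / r)) powr r) \<partial>M)
      = (\<integral>\<^sup>+z\<in>{z. m1 z \<le> i \<and> m2 z \<le> j}. ennreal (\<bar>1 / w z\<bar> powr r * 2 powr - (m1 z + m2 z)) \<partial>M)"
      by presburger
    then show "(\<integral>\<^sup>+z\<in>{z. m1 z \<le> i \<and> m2 z \<le> j}. ennreal ((\<bar>1 / w z\<bar> / 2 powr ((m1 z + m2 z) / r)) powr r) \<partial>M)
      \<le> ennreal (64 * 2 powr (i + j))"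
      using dual[of i j] by simp
  qed (use pr w a in auto)
  show "(\<integral>\<^sup>+z\<in>{z. m1 z \<le> i \<and> m2 z \<le> j}. ennreal \<bar>f z\<bar> \<partial>M) < \<infinity>"
    using le_less_trans[OF block ennreal_less_top] by simp
  \<comment> \<open>By \<open>tail\<close>, \<open>B / 4^((i+j)/r)\<close> bounds the size of \<open>v\<close> on the block \<open>(i,j)\<close>.\<close>
  define t where "t i j = T i j * B / (c * 4 powr ((i + j) / r))" for i j :: int
  have t0: "0 \<le> t i j" for i j using T0[of i j] B c by (simp add: t_def)
  have t_powr: "t i j powr p = a i j * 2 powr - ((p - 1) * (i + j)) / K\<^sup>2" for i j
  proof -
    have "t i j = a i j powr (1 / p) * (64 powr (1 / r) * 2 powr ((i + j) / r)) * B
        / (B * 64 powr (1 / r) * K powr (2 / p) * (2 powr ((i + j) / r) * 2 powr ((i + j) / r)))"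
    proof -
      have "(4::real) powr ((i + j) / r) = (2 * 2) powr ((i + j) / r)" by simp
      also have "\<dots> = 2 powr ((i + j) / r) * 2 powr ((i + j) / r)" by (subst powr_mult) auto
      finally have 4: "(4::real) powr ((i + j) / r) = 2 powr ((i + j) / r) * 2 powr ((i + j) / r)" .
      have "(64 * 2 powr (i + j)) powr (1 / r) = 64 powr (1 / r) * 2 powr ((i + j) / r)"
        by (simp add: powr_mult powr_powr)
      then show ?thesis unfolding t_def T_def c_eq 4 by simp
    qed
    also have "\<dots> = a i j powr (1 / p) / (K powr (2 / p) * 2 powr ((i + j) / r))"
      using B by (simp add: field_simps)
    finally have "t i j powr p = (a i j powr (1 / p)) powr p / ((K powr (2 / p)) powr p * (2 powr ((i + j) / r)) powr p)"
      using K by (simp add: powr_divide powr_mult)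
    also have "(a i j powr (1 / p)) powr p = a i j" using a(2)[of i j] pr by (simp add: powr_powr)
    also have "(K powr (2 / p)) powr p = K\<^sup>2" using K pr by (simp add: powr_powr powr_numeral)
    also have "(2 powr ((i + j) / r)) powr p = 2 powr ((p - 1) * (i + j))"
      using ppr by (simp add: powr_powr mult.commute flip: times_divide_eq_left)
    finally show ?thesis by (simp add: powr_minus_divide)
  qed
  have t_powr_e: "ennreal (t i j powr p) = ennreal (1 / K\<^sup>2) * (A i j * ennreal (2 powr - ((p - 1) * (i + j))))" for i j
    unfolding t_powr a(1) using a(2)[of i j] by (simp flip: ennreal_mult)
  have sum_t: "(\<integral>\<^sup>+i. \<integral>\<^sup>+j. ennreal (t i j powr p) \<partial>count_space UNIV \<partial>count_space UNIV) \<le> 1"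
  proof -
    have "(\<integral>\<^sup>+i. \<integral>\<^sup>+j. ennreal (t i j powr p) \<partial>count_space UNIV \<partial>count_space UNIV)
      = ennreal (1 / K\<^sup>2) * (\<integral>\<^sup>+i. \<integral>\<^sup>+j. A i j * ennreal (2 powr - ((p - 1) * (i + j)))
      \<partial>count_space UNIV \<partial>count_space UNIV)"
      unfolding t_powr_e by (simp add: nn_integral_cmult)
    also have "\<dots> \<le> ennreal (1 / K\<^sup>2) * ennreal (K\<^sup>2)" by (intro mult_left_mono sum_A) simp
    also have "\<dots> = 1" using K by (simp flip: ennreal_mult)
    finally show ?thesis .
  qed
  have t1: "t i j \<le> 1" for i j
  proof -
    have "ennreal (t i j powr p) \<le> ennreal (1 / K\<^sup>2) * ennreal (K\<^sup>2)"
      unfolding t_powr_e by (intro mult_left_mono A_le) simp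
    also have "\<dots> = ennreal 1" using K by (simp flip: ennreal_mult)
    finally have "t i j powr p \<le> 1 powr p" by (simp del: ennreal_1)
    moreover have "1 powr p < t i j powr p" if "1 < t i j"
      using pr that by (intro powr_less_mono2) auto
    ultimately show ?thesis by argo
  qed
  \<comment> \<open>The exchange of sums and integral requires a measurable integrand, so \<open>H\<close> is first replaced
    pointwise by its majorant on each block.\<close>
  let ?\<psi> = "\<lambda>i j z. ennreal (t i j powr p) *
      (ennreal (\<bar>v z * (4 powr ((i + j) / r) / B)\<bar> powr q z) * indicator {z. m1 z = i \<and> m2 z = j} z)"
  have "(\<integral>\<^sup>+z. ennreal (\<bar>H z * v z / c\<bar> powr q z) \<partial>M)
      \<le> (\<integral>\<^sup>+z. \<integral>\<^sup>+i. \<integral>\<^sup>+j. ?\<psi> i j z \<partial>count_space UNIV \<partial>count_space UNIV \<partial>M)"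
  proof (rule nn_integral_mono)
    fix z assume z: "z \<in> space M"
    let ?i = "m1 z" and ?j = "m2 z"
    have HT: "\<bar>H z\<bar> \<le> T ?i ?j"
      using order_trans[OF H[OF z] block] T0 by simp
    let ?y = "\<bar>v z * (4 powr ((?i + ?j) / r) / B)\<bar>"
    have "\<bar>H z * v z / c\<bar> \<le> T ?i ?j * \<bar>v z\<bar> / c"
      using HT c by (simp add: abs_mult abs_divide divide_right_mono mult_right_mono)
    also have "\<dots> = t ?i ?j * ?y"
      using B c by (simp add: t_def abs_mult abs_divide)
    finally have "\<bar>H z * v z / c\<bar> powr q z \<le> (t ?i ?j * ?y) powr q z"
      using q[OF z] pr by (intro powr_mono2) auto
    also have "\<dots> = t ?i ?j powr q z * ?y powr q z"
      by (rule powr_mult)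
    also have "\<dots> \<le> t ?i ?j powr p * ?y powr q z"
      using t0 t1 q[OF z] pr by (intro mult_right_mono powr_mono') auto
    finally have "ennreal (\<bar>H z * v z / c\<bar> powr q z) \<le> ?\<psi> ?i ?j z"
      by (simp flip: ennreal_mult)
    also have "\<dots> \<le> (\<integral>\<^sup>+j. ?\<psi> ?i j z \<partial>count_space UNIV)"
      by (rule nn_integral_ge_point[of ?j UNIV "\<lambda>j. ?\<psi> ?i j z"]) simp
    also have "\<dots> \<le> (\<integral>\<^sup>+i. \<integral>\<^sup>+j. ?\<psi> i j z \<partial>count_space UNIV \<partial>count_space UNIV)"
      by (rule nn_integral_ge_point[of ?i UNIV "\<lambda>i. \<integral>\<^sup>+j. ?\<psi> i j z \<partial>count_space UNIV"]) simp
    finally show "ennreal (\<bar>H z * v z / c\<bar> powr q z)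
      \<le> (\<integral>\<^sup>+i. \<integral>\<^sup>+j. ?\<psi> i j z \<partial>count_space UNIV \<partial>count_space UNIV)" .
  qed
  also have "\<dots> = (\<integral>\<^sup>+i. \<integral>\<^sup>+z. \<integral>\<^sup>+j. ?\<psi> i j z \<partial>count_space UNIV \<partial>M \<partial>count_space UNIV)"
    by (intro nn_integral_count_space_nn_integral borel_measurable_nn_integral_count_space_int) auto
  also have "\<dots> = (\<integral>\<^sup>+i. \<integral>\<^sup>+j. \<integral>\<^sup>+z. ?\<psi> i j z \<partial>M \<partial>count_space UNIV \<partial>count_space UNIV)"
    by (intro nn_integral_cong nn_integral_count_space_nn_integral) auto
  also have "\<dots> \<le> (\<integral>\<^sup>+i. \<integral>\<^sup>+j. ennreal (t i j powr p) \<partial>count_space UNIV \<partial>count_space UNIV)"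
  proof (intro nn_integral_mono)
    fix i j
    have "(\<integral>\<^sup>+z. ?\<psi> i j z \<partial>M) = ennreal (t i j powr p) * (\<integral>\<^sup>+z\<in>{z. m1 z = i \<and> m2 z = j}.
        ennreal (\<bar>v z * (4 powr ((i + j) / r) / B)\<bar> powr q z) \<partial>M)"
      by (rule nn_integral_cmult) measurable
    also have "\<dots> \<le> ennreal (t i j powr p) * 1"
      by (intro mult_left_mono tail) simp
    finally show "(\<integral>\<^sup>+z. ?\<psi> i j z \<partial>M) \<le> ennreal (t i j powr p)" by simp
  qed
  also note sum_t
  finally show "(\<integral>\<^sup>+z. ennreal (\<bar>H z * v z / c\<bar> powr q z) \<partial>M) \<le> 1" .
qed


section \<open>Necessity of the condition\<close>

text \<open>Test functions \<open>f n = w^(-r)\<close> on the part of the rectangle where \<open>w \<ge> 1/(n+1)\<close>. The truncation makes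
  their integrals \<open>I n\<close> finite, so that one may divide by them. The resulting bound for \<open>I n\<close> is uniform in
  \<open>n\<close>, and monotone convergence carries it over to the dual norm.\<close>

lemma norm_tail_times_norm_dual_le:
  fixes p r c :: real and q v w :: "real \<times> real \<Rightarrow> real"
  assumes pr: "1 < p" "1 < r" "1 / p + 1 / r = 1"
    and q: "\<And>z. z \<in> quadrant \<Longrightarrow> 0 \<le> q z"
    and w: "w \<in> borel_measurable (lebesgue_on quadrant)" "AE z in lebesgue_on quadrant. 0 < w z"
    and c: "0 < c"
    and bound: "\<And>f. f \<in> wLq_space (\<lambda>_. p) w \<Longrightarrow> wLq_norm q v (hardy2 f) \<le> ennreal c * wLq_norm (\<lambda>_. p) w f"
    and ab: "0 < a" "0 < b"
  shows "Lq_norm q (\<lambda>z. v z * indicator ({a..} \<times> {b..}) z) *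
       Lq_norm (\<lambda>_. r) (\<lambda>z. 1 / w z * indicator ({0..<a} \<times> {0..<b}) z) \<le> ennreal c"
proof -
  let ?J = "{0..<a} \<times> {0..<b}"
  define K where "K = Lq_norm q (\<lambda>z. v z * indicator ({a..} \<times> {b..}) z)"
  define D where "D = Lq_norm (\<lambda>_. r) (\<lambda>z. 1 / w z * indicator ?J z)"
  note [measurable] = w(1)
  have J_borel: "?J \<in> sets borel" by (simp add: borel_Times)
  have [measurable]: "(\<lambda>z. indicator ?J z :: real) \<in> borel_measurable (lebesgue_on quadrant)"
    by (intro measurable_lebesgue_on_if_borel borel_measurable_indicator J_borel)
  have J_pred[measurable]: "Measurable.pred (lebesgue_on quadrant) (\<lambda>z. z \<in> ?J)"
    by (intro measurable_lebesgue_on_if_borel pred_sets2[OF J_borel]) simp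
  have J_sub: "?J \<subseteq> quadrant" by (auto simp: quadrant_def)
  define f where "f n z = (if z \<in> ?J \<and> 1 / real (Suc n) \<le> w z then (1 / w z) powr r else 0)" for n z
  have f_nonneg: "0 \<le> f n z" for n z by (simp add: f_def)
  have f_meas[measurable]: "f n \<in> borel_measurable (lebesgue_on quadrant)" for n
    unfolding f_def by measurable
  have f_zero: "f n z = 0" if "z \<notin> ?J" for n z using that by (auto simp: f_def)
  define E where "E n = (\<integral>\<^sup>+z. ennreal (f n z) \<partial>lebesgue_on quadrant)" for n
  have E_fin: "E n < top" for n
  proof -
    have le: "f n z \<le> real (Suc n) powr r" for z
    proof (cases "z \<in> ?J \<and> 1 / real (Suc n) \<le> w z")
      case True
      then have "0 < w z" by (smt (verit) divide_pos_pos of_nat_0_less_iff zero_less_Suc)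
      with True have "1 / w z \<le> real (Suc n)" by (simp add: field_simps)
      with \<open>0 < w z\<close> True show ?thesis using pr by (auto simp: f_def intro!: powr_mono2)
    qed (auto simp: f_def)
    have "E n \<le> (\<integral>\<^sup>+z. ennreal (real (Suc n) powr r) * indicator ?J z \<partial>lebesgue)"
      unfolding E_def
      by (subst nn_integral_restrict_space)
         (auto intro!: nn_integral_mono ennreal_leI le simp: indicator_def f_zero
           simp del: of_nat_Suc)
    also have "\<dots> = ennreal (real (Suc n) powr r) * emeasure lborel ?J"
      using J_borel by (subst nn_integral_cmult_indicator) auto
    also have "emeasure lborel ?J = emeasure (lborel \<Otimes>\<^sub>M lborel) ?J" by (simp add: lborel_prod)
    also have "\<dots> = ennreal a * ennreal b"
      using ab by (subst lborel.emeasure_pair_measure_Times) auto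
    also have "ennreal (real (Suc n) powr r) * (ennreal a * ennreal b) < top"
      by (simp add: ennreal_mult_less_top)
    finally show ?thesis .
  qed
  define I where "I n = enn2real (E n)" for n
  have E_I: "E n = ennreal (I n)" and I0: "0 \<le> I n" for n
    using E_fin[of n] by (simp_all add: I_def)
  have hardy_f: "hardy2 (f n) z = I n" if "z \<in> {a..} \<times> {b..}" for n z
  proof -
    obtain x y where z: "z = (x, y)" "a \<le> x" "b \<le> y" using \<open>z \<in> _\<close> by (cases z) auto
    have box: "{0..x} \<times> {0..y} \<in> sets lebesgue" "{0..x} \<times> {0..y} \<subseteq> quadrant"
      by (auto simp: quadrant_def borel_Times)
    have "hardy2 (f n) z = (LINT t|lebesgue. indicator ({0..x} \<times> {0..y}) t *\<^sub>R f n t)"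
      by (simp add: hardy2_def z set_lebesgue_integral_def)
    also have "\<dots> = enn2real (\<integral>\<^sup>+t. ennreal (indicator ({0..x} \<times> {0..y}) t *\<^sub>R f n t) \<partial>lebesgue)"
      using f_nonneg borel_measurable_indicator_scaleR_if_lebesgue_on[OF f_meas box(2,1)]
      by (intro integral_eq_nn_integral) auto
    also have "(\<integral>\<^sup>+t. ennreal (indicator ({0..x} \<times> {0..y}) t *\<^sub>R f n t) \<partial>lebesgue) = E n"
      unfolding E_def
    proof (subst nn_integral_restrict_space, simp, intro nn_integral_cong)
      fix t :: "real \<times> real"
      show "ennreal (indicator ({0..x} \<times> {0..y}) t *\<^sub>R f n t) = ennreal (f n t) * indicator quadrant t"
      proof (cases "t \<in> ?J")
        case True
        then show ?thesis using z(2,3) J_sub by (auto simp: indicator_def)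
      qed (simp add: f_zero)
    qed
    finally show ?thesis by (simp add: I_def)
  qed
  have test: "ennreal (I n) * K \<le> ennreal (c * I n powr (1 / p))" if I: "0 < I n" for n
  proof -
    have "\<bar>f n z * w z\<bar> powr p = f n z" for z
    proof (cases "z \<in> ?J \<and> 1 / real (Suc n) \<le> w z")
      case True
      then have w0: "0 < w z" by (smt (verit) divide_pos_pos of_nat_0_less_iff zero_less_Suc)
      have "f n z * w z = w z powr (1 - r)"
        using True w0 by (simp add: f_def powr_divide powr_diff)
      then have "\<bar>f n z * w z\<bar> powr p = w z powr ((1 - r) * p)"
        by (simp add: powr_powr)
      \<comment> \<open>Conjugacy of \<open>p\<close> and \<open>r\<close> is what makes \<open>(f w)^p\<close> equal to \<open>f\<close>.\<close>
      also have "(1 - r) * p = - r" using pr by (simp add: field_simps)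
      finally show ?thesis using True w0 by (simp add: f_def powr_divide powr_minus_divide)
    qed (auto simp: f_def)
    then have pow: "(\<integral>\<^sup>+z. ennreal (\<bar>f n z * w z\<bar> powr p) \<partial>lebesgue_on quadrant) = ennreal (I n)"
      using E_I[of n] by (simp add: E_def)
    have "wLq_norm (\<lambda>_. p) w (f n) \<le> ennreal (I n powr (1 / p))"
      unfolding wLq_norm_def
    proof (rule Lq_norm_const_le)
      show "(\<integral>\<^sup>+z. ennreal (\<bar>f n z * w z\<bar> powr p) \<partial>lebesgue_on quadrant) \<le> ennreal ((I n powr (1 / p)) powr p)"
        using pr I by (simp add: pow powr_powr)
    qed (use I in auto)
    note nf = this
    have mem: "f n \<in> wLq_space (\<lambda>_. p) w"
      using le_less_trans[OF nf ennreal_less_top] by (simp add: wLq_space_def)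
    have "ennreal (I n) * K \<le> Lq_norm q (\<lambda>z. I n * (v z * indicator ({a..} \<times> {b..}) z))"
      unfolding K_def by (rule Lq_norm_scale_le[OF I])
    also have "\<dots> \<le> Lq_norm q (\<lambda>z. hardy2 (f n) z * v z)"
      using hardy_f by (intro Lq_norm_mono q) (auto simp: indicator_def)
    also have "\<dots> \<le> ennreal c * wLq_norm (\<lambda>_. p) w (f n)"
      using bound[OF mem] by (simp add: wLq_norm_def)
    also have "\<dots> \<le> ennreal c * ennreal (I n powr (1 / p))"
      by (intro mult_left_mono nf) simp
    finally show ?thesis using c by (simp flip: ennreal_mult)
  qed
  have mono_conv: "(\<integral>\<^sup>+z. ennreal (\<bar>1 / w z * indicator ?J z\<bar> powr r) \<partial>lebesgue_on quadrant) \<le> (SUP n. E n)"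
  proof -
    have "(\<integral>\<^sup>+z. ennreal (\<bar>1 / w z * indicator ?J z\<bar> powr r) \<partial>lebesgue_on quadrant)
        \<le> (\<integral>\<^sup>+z. (SUP n. ennreal (f n z)) \<partial>lebesgue_on quadrant)"
    proof (rule nn_integral_mono_AE)
      show "AE z in lebesgue_on quadrant. ennreal (\<bar>1 / w z * indicator ?J z\<bar> powr r) \<le> (SUP n. ennreal (f n z))"
        using w(2)
      proof eventually_elim
        case (elim z)
        obtain n where n: "inverse (real (Suc n)) < w z" using reals_Archimedean[OF elim] by blast
        have "\<bar>1 / w z * indicator ?J z\<bar> powr r = f n z"
          using n elim by (auto simp: f_def indicator_def inverse_eq_divide)
        then show ?case by (metis SUP_upper UNIV_I)
      qed
    qed
    also have "\<dots> = (SUP n. E n)"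
      unfolding E_def
    proof (rule nn_integral_monotone_convergence_SUP)
      show "incseq (\<lambda>n z. ennreal (f n z))"
      proof (intro monoI le_funI ennreal_leI)
        fix m n :: nat and z assume "m \<le> n"
        then have "1 / real (Suc n) \<le> 1 / real (Suc m)" by (simp add: frac_le)
        then show "f m z \<le> f n z" by (auto simp: f_def)
      qed
    qed measurable
    finally show ?thesis .
  qed
  have D_le: "D \<le> ennreal l" if l: "0 < l" "\<And>n. I n \<le> l powr r" for l
    unfolding D_def
  proof (rule Lq_norm_const_le)
    show "(\<integral>\<^sup>+z. ennreal (\<bar>1 / w z * indicator ?J z\<bar> powr r) \<partial>lebesgue_on quadrant) \<le> ennreal (l powr r)"
      using l(2) by (intro order_trans[OF mono_conv] SUP_least) (simp add: E_I)
  qed (use l in auto)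
  have "K * D \<le> ennreal c"
    \<comment> \<open>With \<open>0 * \<infinity> = 0\<close> the product vanishes here even if the other norm is infinite.\<close>
  proof (cases "K = 0 \<or> D = 0")
    case False
    then have "\<exists>n. 0 < I n"
    proof (rule contrapos_np)
      assume "\<nexists>n. 0 < I n"
      then have "I n = 0" for n using I0[of n] by (metis less_eq_real_def)
      then have "D \<le> ennreal e" if "0 < e" for e using D_le[OF that] by simp
      then have "D \<le> 0 + ennreal e" if "0 < e" for e using that by simp
      then have "D \<le> 0" by (rule ennreal_le_epsilon)
      then show "K = 0 \<or> D = 0" by simp
    qed
    then obtain n0 where n0: "0 < I n0" by blast
    have "K \<noteq> top"
      using test[OF n0] n0 by (auto simp: ennreal_mult_top top_unique)
    then obtain k where k: "K = ennreal k" "0 \<le> k" by (cases K) auto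
    with False have k0: "0 < k" by (cases "k = 0") auto
    have "I n \<le> (c / k) powr r" for n
    proof (cases "I n = 0")
      case False
      with I0[of n] have In: "0 < I n" by simp
      have "I n * k \<le> c * I n powr (1 / p)"
        using test[OF In] k In c by (simp flip: ennreal_mult)
      then have "I n / I n powr (1 / p) \<le> c / k"
        using In k0 by (simp add: field_simps)
      moreover have "I n powr (1 / r) = I n / I n powr (1 / p)"
      proof -
        have "1 / r = 1 - 1 / p" using pr by simp
        then show ?thesis using In by (simp add: powr_diff)
      qed
      ultimately have "(I n powr (1 / r)) powr r \<le> (c / k) powr r"
        using pr In by (intro powr_mono2) auto
      then show ?thesis using pr In by (simp add: powr_powr)
    qed simp
    then have "D \<le> ennreal (c / k)" using c k0 by (intro D_le) auto
    then have "K * D \<le> ennreal k * ennreal (c / k)" unfolding k(1) by (intro mult_left_mono) auto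
    also have "\<dots> = ennreal c" using c k0 by (simp flip: ennreal_mult)
    finally show ?thesis .
  qed auto
  then show ?thesis by (simp add: K_def D_def)
qed


section \<open>Sufficiency of the condition\<close>

text \<open>The tail norms of \<open>v\<close> are positive, so the condition makes the primitives of \<open>w1^(-r)\<close> and \<open>w2^(-r)\<close>
  finite and \<open>dyadic_levels\<close> applies to both. It remains to verify the hypotheses of
  \<open>level_modular_bound\<close> on the open quadrant and to undo the normalisation of \<open>f\<close>.\<close>

lemma hardy2_bounded_if_product_condition:
  fixes p r B0 :: real and q v w :: "real \<times> real \<Rightarrow> real" and w1 w2 :: "real \<Rightarrow> real"
  assumes qm: "q \<in> borel_measurable (lebesgue_on quadrant)"
    and pr: "1 < p" "1 < r" "1 / p + 1 / r = 1"
    and q: "\<And>z. z \<in> quadrant \<Longrightarrow> p \<le> q z"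
    and v: "weight_on quadrant v" and w: "weight_on quadrant w"
    and w1: "weight_on {0..} w1" and w2: "weight_on {0..} w2"
    and wprod: "\<And>x y. 0 \<le> x \<Longrightarrow> 0 \<le> y \<Longrightarrow> w (x, y) = w1 x * w2 y"
    and B0: "0 \<le> B0"
    and cond: "\<And>a b. 0 < a \<Longrightarrow> 0 < b \<Longrightarrow> Lq_norm q (\<lambda>z. v z * indicator ({a..} \<times> {b..}) z) *
       Lq_norm (\<lambda>_. r) (\<lambda>z. 1 / w z * indicator ({0..<a} \<times> {0..<b}) z) \<le> ennreal B0"
  shows "hardy2_bounded p w q v"
proof -
  define K where "K a b = Lq_norm q (\<lambda>z. v z * indicator ({a..} \<times> {b..}) z)" for a b
  define D where "D a b = Lq_norm (\<lambda>_. r) (\<lambda>z. 1 / w z * indicator ({0..<a} \<times> {0..<b}) z)" for a b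
  have KD: "K a b * D a b \<le> ennreal B0" if "0 < a" "0 < b" for a b
    using cond[OF that] by (simp add: K_def D_def)
  have vm[measurable]: "v \<in> borel_measurable (lebesgue_on quadrant)"
    and v0: "AE z in lebesgue. z \<in> quadrant \<longrightarrow> 0 < v z"
    using v by (auto simp: weight_on_def AE_restrict_space_iff)
  have wm[measurable]: "w \<in> borel_measurable (lebesgue_on quadrant)"
    and w0: "AE z in lebesgue. z \<in> quadrant \<longrightarrow> 0 < w z"
    using w by (auto simp: weight_on_def AE_restrict_space_iff)
  have w1m[measurable]: "w1 \<in> borel_measurable (lebesgue_on {0..})"
    and w2m[measurable]: "w2 \<in> borel_measurable (lebesgue_on {0..})"
    using w1 w2 by (auto simp: weight_on_def)
  have ind_m: "(\<lambda>z. indicator (X \<times> Y) z :: real) \<in> borel_measurable (lebesgue_on quadrant)"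
    if "X \<in> sets borel" "Y \<in> sets borel" for X Y :: "real set"
    using that by (intro measurable_lebesgue_on_if_borel borel_measurable_indicator borel_Times)
  have K_meas: "(\<lambda>z. v z * indicator ({a..} \<times> {b..}) z) \<in> borel_measurable (lebesgue_on quadrant)" for a b
    by (intro borel_measurable_times vm ind_m) auto
  have D_meas: "(\<lambda>z. 1 / w z * indicator ({0..<a} \<times> {0..<b}) z) \<in> borel_measurable (lebesgue_on quadrant)" for a b
    by (intro borel_measurable_times borel_measurable_divide borel_measurable_const wm ind_m) auto
  define s1 s2 where "s1 x = \<bar>1 / w1 x\<bar> powr r" and "s2 x = \<bar>1 / w2 x\<bar> powr r" for x
  have s1m: "s1 \<in> borel_measurable (lebesgue_on {0..})" and s2m: "s2 \<in> borel_measurable (lebesgue_on {0..})"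
    unfolding s1_def s2_def by measurable
  define S1 S2 where "S1 a = (\<integral>\<^sup>+x\<in>{0..<a}. ennreal (s1 x) \<partial>lebesgue)"
    and "S2 a = (\<integral>\<^sup>+x\<in>{0..<a}. ennreal (s2 x) \<partial>lebesgue)" for a
  have S_pos: "0 < S1 a" "0 < S2 a" if "0 < a" for a
    unfolding S1_def S2_def s1_def s2_def
    by (rule nn_integral_powr_weight_pos[OF w1 that] nn_integral_powr_weight_pos[OF w2 that])+
  have S_prod: "(\<integral>\<^sup>+z. ennreal (\<bar>1 / w z * indicator ({0..<a} \<times> {0..<b}) z\<bar> powr r) \<partial>lebesgue_on quadrant)
      = S1 a * S2 b" for a b
  proof -
    have "(\<integral>\<^sup>+z. ennreal (\<bar>1 / w z * indicator ({0..<a} \<times> {0..<b}) z\<bar> powr r) \<partial>lebesgue_on quadrant)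
      = (\<integral>\<^sup>+z\<in>{0..<a} \<times> {0..<b}. ennreal (\<bar>1 / w z\<bar> powr r * (1 * 1)) \<partial>lebesgue)"
    proof (subst nn_integral_restrict_space, simp, intro nn_integral_cong)
      fix z :: "real \<times> real"
      show "ennreal (\<bar>1 / w z * indicator ({0..<a} \<times> {0..<b}) z\<bar> powr r) * indicator quadrant z
        = ennreal (\<bar>1 / w z\<bar> powr r * (1 * 1)) * indicator ({0..<a} \<times> {0..<b}) z"
        by (cases z) (auto simp: indicator_def quadrant_def)
    qed
    also have "\<dots> = (\<integral>\<^sup>+x\<in>{0..<a}. ennreal (1 * \<bar>1 / w1 x\<bar> powr r) \<partial>lebesgue)
        * (\<integral>\<^sup>+y\<in>{0..<b}. ennreal (1 * \<bar>1 / w2 y\<bar> powr r) \<partial>lebesgue)"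
      by (rule nn_integral_product_weight[OF w1m w2m wprod]) auto
    also have "\<dots> = S1 a * S2 b" by (simp add: S1_def S2_def s1_def s2_def)
    finally show ?thesis .
  qed
  have K_pos: "0 < K a b" for a b
    unfolding K_def
  proof (rule Lq_norm_pos[OF K_meas qm _ q])
    show "0 < p" using pr by simp
    show "\<not> (AE z in lebesgue_on quadrant. v z * indicator ({a..} \<times> {b..}) z = 0)"
    proof
      assume "AE z in lebesgue_on quadrant. v z * indicator ({a..} \<times> {b..}) z = 0"
      then have "AE z in lebesgue. z \<in> quadrant \<longrightarrow> v z * indicator ({a..} \<times> {b..}) z = 0"
        by (simp add: AE_restrict_space_iff)
      then have "AE z in lebesgue. z \<notin> {max a 0..} \<times> {max b 0..}"
        using v0 by eventually_elim (auto simp: quadrant_def indicator_def split: if_splits)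
      then have "AE z in lborel \<Otimes>\<^sub>M lborel. z \<notin> {max a 0..} \<times> {max b 0..}"
        by (simp only: AE_completion_iff lborel_prod)
      then have "emeasure (lborel \<Otimes>\<^sub>M lborel) ({max a 0..} \<times> {max b 0..}) = 0"
        by (subst (asm) AE_iff_null_sets[symmetric]) (auto simp: null_sets_def)
      moreover have "emeasure (lborel \<Otimes>\<^sub>M lborel) ({max a 0..} \<times> {max b 0..})
          \<ge> emeasure (lborel \<Otimes>\<^sub>M lborel) ({max a 0..max a 0 + 1} \<times> {max b 0..max b 0 + 1})"
        by (intro emeasure_mono) auto
      ultimately show False by (auto simp: lborel.emeasure_pair_measure_Times)
    qed
  qed
  have S_prod_fin: "S1 a * S2 b < top" if ab: "0 < a" "0 < b" for a b
  proof -
    have "D a b \<noteq> top"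
      using KD[OF ab] K_pos[of a b] by (auto simp: ennreal_mult_top top_unique split: if_splits)
    then have "D a b < ennreal (enn2real (D a b) + 1)"
      by (cases "D a b") (auto simp: ennreal_less_iff)
    then have "S1 a * S2 b \<le> ennreal ((enn2real (D a b) + 1) powr r)"
      unfolding S_prod[symmetric] D_def
      using pr by (intro integral_le_if_Lq_norm_const_less[OF D_meas]) auto
    then show ?thesis using le_less_trans ennreal_less_top by blast
  qed
  have S_fin: "S1 a < top" "S2 a < top" if a: "0 < a" for a
    using S_prod_fin[OF a zero_less_one] S_prod_fin[OF zero_less_one a] S_pos[of a] S_pos[of 1] a
    by (auto simp: ennreal_mult_less_top)
  obtain n1 :: "real \<Rightarrow> int" where n1m[measurable]: "n1 \<in> borel \<rightarrow>\<^sub>M count_space UNIV"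
    and n1_mono: "\<And>x y. 0 < x \<Longrightarrow> x \<le> y \<Longrightarrow> n1 x \<le> n1 y"
    and n1_int: "\<And>i. (\<integral>\<^sup>+x\<in>{x. 0 < x \<and> n1 x \<le> i}. ennreal (2 powr - n1 x * s1 x) \<partial>lebesgue) \<le> ennreal (8 * 2 powr i)"
    and n1_pt: "\<And>x. 0 < x \<Longrightarrow> \<exists>a>0. (\<forall>y>0. n1 y = n1 x \<longrightarrow> a \<le> y) \<and> ennreal (4 powr n1 x) \<le> S1 a"
    using dyadic_levels[OF s1m, folded S1_def] S_fin S_pos by (auto simp: s1_def)
  obtain n2 :: "real \<Rightarrow> int" where n2m[measurable]: "n2 \<in> borel \<rightarrow>\<^sub>M count_space UNIV"
    and n2_mono: "\<And>x y. 0 < x \<Longrightarrow> x \<le> y \<Longrightarrow> n2 x \<le> n2 y"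
    and n2_int: "\<And>i. (\<integral>\<^sup>+x\<in>{x. 0 < x \<and> n2 x \<le> i}. ennreal (2 powr - n2 x * s2 x) \<partial>lebesgue) \<le> ennreal (8 * 2 powr i)"
    and n2_pt: "\<And>x. 0 < x \<Longrightarrow> \<exists>a>0. (\<forall>y>0. n2 y = n2 x \<longrightarrow> a \<le> y) \<and> ennreal (4 powr n2 x) \<le> S2 a"
    using dyadic_levels[OF s2m, folded S2_def] S_fin S_pos by (auto simp: s2_def)
  define Q where "Q = {0::real<..} \<times> {0::real<..}"
  have QB: "Q \<in> sets borel" unfolding Q_def by (simp add: borel_Times)
  have Q_sub: "Q \<subseteq> quadrant" by (auto simp: Q_def quadrant_def)
  have space_Q: "space (lebesgue_on Q) = Q" by simp
  define m1 m2 where "m1 z = n1 (fst z)" and "m2 z = n2 (snd z)" for z :: "real \<times> real"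
  have m_meas: "m1 \<in> lebesgue_on Q \<rightarrow>\<^sub>M count_space UNIV" "m2 \<in> lebesgue_on Q \<rightarrow>\<^sub>M count_space UNIV"
    unfolding m1_def m2_def
    by (intro measurable_lebesgue_on_if_borel measurable_compose[OF _ n1m] measurable_compose[OF _ n2m]
        borel_measurable_continuous_onI continuous_intros)+
  \<comment> \<open>Strictly above \<open>B0\<close>, since the modular is controlled only above the norm.\<close>
  define B where "B = B0 + 1"
  have B: "0 < B" using B0 by (simp add: B_def)
  have dual: "(\<integral>\<^sup>+z\<in>{z. m1 z \<le> i \<and> m2 z \<le> j}.
        ennreal (\<bar>1 / w z\<bar> powr r * 2 powr - (m1 z + m2 z)) \<partial>lebesgue_on Q) \<le> ennreal (64 * 2 powr (i + j))" for i j
  proof -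
    let ?X = "{x. 0 < x \<and> n1 x \<le> i}" and ?Y = "{x. 0 < x \<and> n2 x \<le> j}"
    have "(\<integral>\<^sup>+z\<in>{z. m1 z \<le> i \<and> m2 z \<le> j}. ennreal (\<bar>1 / w z\<bar> powr r * 2 powr - (m1 z + m2 z)) \<partial>lebesgue_on Q)
      = (\<integral>\<^sup>+z\<in>?X \<times> ?Y. ennreal (\<bar>1 / w z\<bar> powr r * (2 powr - n1 (fst z) * 2 powr - n2 (snd z))) \<partial>lebesgue)"
    proof (subst nn_integral_restrict_space, use QB in simp, intro nn_integral_cong)
      fix z :: "real \<times> real"
      have "2 powr - (m1 z + m2 z) = (2::real) powr - n1 (fst z) * 2 powr - n2 (snd z)"
        by (simp add: m1_def m2_def flip: powr_add)
      then show "ennreal (\<bar>1 / w z\<bar> powr r * 2 powr - (m1 z + m2 z)) * indicator {z. m1 z \<le> i \<and> m2 z \<le> j} z * indicator Q z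
        = ennreal (\<bar>1 / w z\<bar> powr r * (2 powr - n1 (fst z) * 2 powr - n2 (snd z))) * indicator (?X \<times> ?Y) z"
        by (simp only:) (cases z, auto simp: indicator_def Q_def m1_def m2_def)
    qed
    also have "\<dots> = (\<integral>\<^sup>+x\<in>?X. ennreal (2 powr - n1 x * s1 x) \<partial>lebesgue) * (\<integral>\<^sup>+x\<in>?Y. ennreal (2 powr - n2 x * s2 x) \<partial>lebesgue)"
      unfolding s1_def s2_def
    proof (rule nn_integral_product_weight[OF w1m w2m wprod])
      show "?X \<in> sets borel" "?Y \<in> sets borel" by measurable
    qed auto
    also have "\<dots> \<le> ennreal (8 * 2 powr i) * ennreal (8 * 2 powr j)"
      by (intro mult_mono n1_int n2_int) auto
    also have "\<dots> = ennreal (64 * 2 powr (i + j))"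
      by (simp add: powr_add flip: ennreal_mult)
    finally show ?thesis by simp
  qed
  have tail: "(\<integral>\<^sup>+z\<in>{z. m1 z = i \<and> m2 z = j}.
        ennreal (\<bar>v z * (4 powr ((i + j) / r) / B)\<bar> powr q z) \<partial>lebesgue_on Q) \<le> 1" for i j
  proof (cases "\<exists>z\<in>Q. m1 z = i \<and> m2 z = j")
    case False
    then have "(\<integral>\<^sup>+z\<in>{z. m1 z = i \<and> m2 z = j}.
        ennreal (\<bar>v z * (4 powr ((i + j) / r) / B)\<bar> powr q z) \<partial>lebesgue_on Q) = (\<integral>\<^sup>+z. 0 \<partial>lebesgue_on Q)"
      by (intro nn_integral_cong) (auto simp: indicator_def)
    then show ?thesis by simp
  next
    case True
    then obtain x y where xy: "0 < x" "0 < y" "n1 x = i" "n2 y = j"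
      by (auto simp: Q_def m1_def m2_def)
    \<comment> \<open>\<open>(a, b)\<close> is the lower left corner of the block.\<close>
    obtain a where a: "0 < a" "\<And>t. 0 < t \<Longrightarrow> n1 t = i \<Longrightarrow> a \<le> t" "ennreal (4 powr i) \<le> S1 a"
      using n1_pt[OF xy(1)] xy(3) by auto
    obtain b where b: "0 < b" "\<And>t. 0 < t \<Longrightarrow> n2 t = j \<Longrightarrow> b \<le> t" "ennreal (4 powr j) \<le> S2 b"
      using n2_pt[OF xy(2)] xy(4) by auto
    define s where "s = (4::real) powr ((i + j) / r)"
    have s: "0 < s" by (simp add: s_def)
    have "ennreal ((4 powr i * 4 powr j) powr (1 / r)) \<le> D a b"
      unfolding D_def
    proof (rule le_Lq_norm_const[OF D_meas])
      have "ennreal (4 powr i * 4 powr j) = ennreal (4 powr i) * ennreal (4 powr j)" by (simp add: ennreal_mult)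
      also have "\<dots> \<le> S1 a * S2 b" using a b by (intro mult_mono) auto
      finally show "ennreal (4 powr i * 4 powr j)
          \<le> (\<integral>\<^sup>+z. ennreal (\<bar>1 / w z * indicator ({0..<a} \<times> {0..<b}) z\<bar> powr r) \<partial>lebesgue_on quadrant)"
        by (simp only: S_prod)
    qed (use pr in auto)
    moreover have "((4::real) powr i * 4 powr j) powr (1 / r) = s"
      by (simp add: s_def powr_powr flip: powr_add)
    ultimately have sD: "ennreal s \<le> D a b" by simp
    have Ks: "K a b * ennreal s \<le> ennreal B0"
      using mult_left_mono[OF sD, of "K a b"] KD[OF a(1) b(1)] by (auto intro: order_trans)
    have "K a b < ennreal (B / s)"
    proof -
      have "K a b \<noteq> top" using Ks s by (auto simp: ennreal_top_mult top_unique)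
      then obtain k where k: "K a b = ennreal k" "0 \<le> k" by (cases "K a b") auto
      have "k * s \<le> B0" using Ks k s B0 by (simp flip: ennreal_mult)
      then have "k < B / s" using s by (simp add: B_def field_simps)
      then show ?thesis using k by (simp add: ennreal_less_iff)
    qed
    then have le1: "(\<integral>\<^sup>+z. ennreal (\<bar>v z * indicator ({a..} \<times> {b..}) z / (B / s)\<bar> powr q z) \<partial>lebesgue_on quadrant) \<le> 1"
      unfolding K_def using q pr by (intro modular_le_1_if_Lq_norm_less) (auto intro: order_trans[of 0 p])
    have "(\<integral>\<^sup>+z\<in>{z. m1 z = i \<and> m2 z = j}. ennreal (\<bar>v z * (s / B)\<bar> powr q z) \<partial>lebesgue_on Q)
      \<le> (\<integral>\<^sup>+z. ennreal (\<bar>v z * indicator ({a..} \<times> {b..}) z / (B / s)\<bar> powr q z) \<partial>lebesgue_on Q)"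
      using a(2) b(2) by (intro nn_integral_mono) (auto simp: indicator_def Q_def m1_def m2_def)
    also have "\<dots> \<le> 1" using le1 by (simp add: nn_integral_quadrant_interior Q_def)
    finally show ?thesis by (simp add: s_def)
  qed
  have box: "(\<integral>\<^sup>+t\<in>{0..x} \<times> {0..y}. g t \<partial>lebesgue)
      \<le> (\<integral>\<^sup>+t\<in>{t. m1 t \<le> n1 x \<and> m2 t \<le> n2 y}. g t \<partial>lebesgue_on Q)" if "0 < x" "0 < y" for x y and g :: "real \<times> real \<Rightarrow> ennreal"
  proof (subst nn_integral_restrict_space, use QB in simp, rule nn_integral_mono_AE)
    show "AE t in lebesgue. g t * indicator ({0..x} \<times> {0..y}) t
        \<le> g t * indicator {t. m1 t \<le> n1 x \<and> m2 t \<le> n2 y} t * indicator Q t"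
      using AE_off_axes
      by eventually_elim (auto simp: indicator_def Q_def m1_def m2_def intro!: n1_mono n2_mono)
  qed
  define c where "c = B * 64 powr (1 / r) * (1 / (1 - 2 powr - (p - 1))) powr (2 / p)"
  have c: "0 < c"
    unfolding c_def using B pr powr_less_one[of 2 "- (p - 1)"] by (intro mult_pos_pos) auto
  \<comment> \<open>A scale \<open>l\<close> above the norm, rather than the norm itself, also covers functions of norm 0.\<close>
  have key: "(\<forall>(x, y)\<in>quadrant. set_integrable lebesgue ({0..x} \<times> {0..y}) f) \<and>
      wLq_norm q v (hardy2 f) \<le> ennreal (c * l)"
    if f: "f \<in> borel_measurable (lebesgue_on quadrant)" and l: "0 < l" "wLq_norm (\<lambda>_. p) w f < ennreal l" for f l
  proof -
    define g where "g z = f z / l" for z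
    have gm: "g \<in> borel_measurable (lebesgue_on quadrant)" unfolding g_def using f by measurable
    have "(\<integral>\<^sup>+z. ennreal (\<bar>f z * w z / l\<bar> powr p) \<partial>lebesgue_on quadrant) \<le> 1"
      using modular_le_1_if_Lq_norm_less[OF l(2)[unfolded wLq_norm_def]] pr by simp
    then have g1: "(\<integral>\<^sup>+z. ennreal (\<bar>g z * w z\<bar> powr p) \<partial>lebesgue_on Q) \<le> 1"
      by (simp add: g_def nn_integral_quadrant_interior Q_def)
    have meas: "h \<in> borel_measurable (lebesgue_on Q)" if "h \<in> borel_measurable (lebesgue_on quadrant)"
      for h :: "real \<times> real \<Rightarrow> real"
      using that Q_sub by (rule measurable_restrict_mono)
    have wQ: "AE z in lebesgue_on Q. w z \<noteq> 0"
      using w0 QB Q_sub by (subst AE_restrict_space_iff) (auto elim!: AE_mp)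
    have H: "ennreal \<bar>hardy2 g z\<bar> \<le> (\<integral>\<^sup>+t\<in>{t. m1 t \<le> m1 z \<and> m2 t \<le> m2 z}. ennreal \<bar>g t\<bar> \<partial>lebesgue_on Q)"
      if zQ: "z \<in> space (lebesgue_on Q)" for z
    proof -
      obtain x y where z: "z = (x, y)" "0 < x" "0 < y" using zQ by (auto simp: Q_def)
      show ?thesis
        using order_trans[OF abs_hardy2_le box[OF z(2,3)]] by (simp add: z(1) m1_def m2_def)
    qed
    note bound = level_modular_bound[OF m_meas meas[OF gm] meas[OF wm] meas[OF vm] meas[OF qm] wQ pr _ B dual tail g1 H,
        folded c_def]
    have qQ: "\<And>z. z \<in> space (lebesgue_on Q) \<Longrightarrow> p \<le> q z" using q Q_sub by auto
    have fin: "(\<integral>\<^sup>+z\<in>{z. m1 z \<le> i \<and> m2 z \<le> j}. ennreal \<bar>g z\<bar> \<partial>lebesgue_on Q) < \<infinity>" for i j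
      by (rule bound(1)[OF qQ])
    have "(\<integral>\<^sup>+z. ennreal (\<bar>hardy2 g z * v z / c\<bar> powr q z) \<partial>lebesgue_on Q) \<le> 1"
      by (rule bound(2)[OF qQ])
    moreover have "hardy2 g z * v z / c = hardy2 f z * v z / (c * l)" for z
    proof -
      have "g = (\<lambda>z. f z / l)" by (auto simp: g_def)
      then show ?thesis by (simp add: hardy2_scale mult.commute)
    qed
    ultimately have "(\<integral>\<^sup>+z. ennreal (\<bar>hardy2 f z * v z / (c * l)\<bar> powr q z) \<partial>lebesgue_on quadrant) \<le> 1"
      by (simp only: nn_integral_quadrant_interior Q_def)
    then have "wLq_norm q v (hardy2 f) \<le> ennreal (c * l)"
      unfolding wLq_norm_def using c l by (intro Lq_norm_le) auto
    moreover have "set_integrable lebesgue ({0..x} \<times> {0..y}) f" if xy: "(x, y) \<in> quadrant" for x y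
    proof -
      \<comment> \<open>Enlarging the rectangle moves its corner off the axes, where levels are defined.\<close>
      have x1: "0 < x + 1" "0 < y + 1" using xy by (auto simp: quadrant_def)
      have "set_integrable lebesgue ({0..x + 1} \<times> {0..y + 1}) g"
      proof (rule set_integrable_if_nn_integral_finite[OF gm])
        show "(\<integral>\<^sup>+z\<in>{0..x + 1} \<times> {0..y + 1}. ennreal \<bar>g z\<bar> \<partial>lebesgue) < \<infinity>"
          by (rule le_less_trans[OF box[OF x1] fin])
      qed (auto simp: quadrant_def borel_Times)
      then have "set_integrable lebesgue ({0..x} \<times> {0..y}) g"
        by (rule set_integrable_subset) (auto simp: borel_Times)
      then have "set_integrable lebesgue ({0..x} \<times> {0..y}) (\<lambda>z. l * g z)"
        by simp
      then show ?thesis using l by (simp add: g_def)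
    qed
    ultimately show ?thesis by auto
  qed
  show ?thesis
    unfolding hardy2_bounded_def
  proof (intro exI[of _ c] conjI ballI c)
    fix f assume "f \<in> wLq_space (\<lambda>_. p) w"
    then have fm: "f \<in> borel_measurable (lebesgue_on quadrant)" and "wLq_norm (\<lambda>_. p) w f < \<infinity>"
      by (auto simp: wLq_space_def)
    then obtain \<nu> where \<nu>: "wLq_norm (\<lambda>_. p) w f = ennreal \<nu>" "0 \<le> \<nu>"
      by (cases "wLq_norm (\<lambda>_. p) w f") auto
    have less: "wLq_norm (\<lambda>_. p) w f < ennreal (\<nu> + e)" if "0 < e" for e
      using that \<nu> by (simp add: ennreal_less_iff)
    show "case z of (x, y) \<Rightarrow> set_integrable lebesgue ({0..x} \<times> {0..y}) f" if "z \<in> quadrant" for z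
      using key[OF fm _ less[OF zero_less_one]] \<nu> that by auto
    show "wLq_norm q v (hardy2 f) \<le> ennreal c * wLq_norm (\<lambda>_. p) w f"
    proof (rule ennreal_le_epsilon)
      fix e :: real assume e: "0 < e"
      then have "wLq_norm q v (hardy2 f) \<le> ennreal (c * (\<nu> + e / c))"
        using key[OF fm _ less[of "e / c"]] \<nu> c by (auto simp: add_nonneg_pos)
      also have "c * (\<nu> + e / c) = c * \<nu> + e" using c by (simp add: field_simps)
      also have "ennreal (c * \<nu> + e) = ennreal c * wLq_norm (\<lambda>_. p) w f + ennreal e"
        using c e \<nu> by (simp add: ennreal_mult)
      finally show "wLq_norm q v (hardy2 f) \<le> ennreal c * wLq_norm (\<lambda>_. p) w f + ennreal e" .
    qed
  qed
qed


section \<open>The characterisation\<close>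

theorem theorem3p1:
  fixes p :: real
    and q v w :: "real \<times> real \<Rightarrow> real"
    and w1 w2 :: "real \<Rightarrow> real"
  assumes "q \<in> borel_measurable (lebesgue_on quadrant)"
    and "1 < p"
    and "ereal p \<le> exp_minus q"
    and "exp_minus q \<le> exp_plus q"
    and "exp_plus q < \<infinity>"
    and "weight_on quadrant v"
    and "weight_on quadrant w"
    and "weight_on {0..} w1"
    and "weight_on {0..} w2"
    and "\<And>x y. 0 \<le> x \<Longrightarrow> 0 \<le> y \<Longrightarrow> w (x, y) = w1 x * w2 y"
  shows "hardy2_bounded p w q v \<longleftrightarrow>
    (SUP (a, b) \<in> {0<..} \<times> {0<..}.
       Lq_norm q (\<lambda>z. v z * indicator ({a..} \<times> {b..}) z) *
       Lq_norm (\<lambda>_. p / (p - 1)) (\<lambda>z. 1 / w z * indicator ({0..<a} \<times> {0..<b}) z)) < \<infinity>"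
    (is "_ \<longleftrightarrow> ?B < \<infinity>")
proof -
  define r where "r = p / (p - 1)"
  have pr: "1 < p" "1 < r" "1 / p + 1 / r = 1"
    using assms(2) by (auto simp: r_def field_simps)
  have q: "p \<le> q z" if "z \<in> quadrant" for z
  proof -
    have "ereal p \<le> ereal (q z)"
      using assms(3) that unfolding exp_minus_def by (auto simp: le_INF_iff)
    then show ?thesis by simp
  qed
  show ?thesis
  proof
    assume "hardy2_bounded p w q v"
    then obtain c where c: "0 < c" "\<And>f. f \<in> wLq_space (\<lambda>_. p) w \<Longrightarrow>
        wLq_norm q v (hardy2 f) \<le> ennreal c * wLq_norm (\<lambda>_. p) w f"
      unfolding hardy2_bounded_def by blast
    have "?B \<le> ennreal c"
    proof (rule SUP_least, clarify)
      fix a b :: real assume ab: "0 < a" "0 < b"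
      have q0: "0 \<le> q z" if "z \<in> quadrant" for z using q[OF that] pr(1) by simp
      have w: "w \<in> borel_measurable (lebesgue_on quadrant)" "AE z in lebesgue_on quadrant. 0 < w z"
        using assms(7) by (auto simp: weight_on_def)
      show "Lq_norm q (\<lambda>z. v z * indicator ({a..} \<times> {b..}) z) *
          Lq_norm (\<lambda>_. p / (p - 1)) (\<lambda>z. 1 / w z * indicator ({0..<a} \<times> {0..<b}) z) \<le> ennreal c"
        using norm_tail_times_norm_dual_le[OF pr q0 w c ab] by (simp only: r_def)
    qed
    then show "?B < \<infinity>" by (simp add: le_less_trans)
  next
    assume B: "?B < \<infinity>"
    show "hardy2_bounded p w q v"
    proof (rule hardy2_bounded_if_product_condition[OF assms(1) pr q assms(6-10)])
      show "0 \<le> enn2real ?B" by simp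
      fix a b :: real assume "0 < a" "0 < b"
      then have "Lq_norm q (\<lambda>z. v z * indicator ({a..} \<times> {b..}) z) *
          Lq_norm (\<lambda>_. r) (\<lambda>z. 1 / w z * indicator ({0..<a} \<times> {0..<b}) z) \<le> ?B"
        unfolding r_def by (intro SUP_upper2[of "(a, b)"]) auto
      also have "?B = ennreal (enn2real ?B)" using B by simp
      finally show "Lq_norm q (\<lambda>z. v z * indicator ({a..} \<times> {b..}) z) *
          Lq_norm (\<lambda>_. r) (\<lambda>z. 1 / w z * indicator ({0..<a} \<times> {0..<b}) z) \<le> ennreal (enn2real ?B)" .
    qed
  qed
qed

end
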